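(* Consider two players A and B who are attacked according to two independent ordinary Poisson processes $\mathcal A=\sum_{j\ge1}w_j\varepsilon_{s_j}$ and $\mathcal B=\sum_{k\ge1}z_k\varepsilon_{t_k}$ of intensities $\lambda$ and $\mu$, where $\varepsilon_x$ is the Dirac point mass at $x$, $s_1>0$ and $t_1>0$, the $s_j$ and $t_k$ are the times of attacks on A and B, and the damages $w_j$ and $z_k$ are equal to $1$ a.s. The game is observed at the epochs $\tau_1,\tau_2,\ldots$ of a renewal process whose inter-renewal times $\Delta_1=\tau_1,\ \Delta_2=\tau_2-\tau_1,\ldots$ are exponentially distributed with parameter $\gamma$. Let $X_i$ and $Y_i$ be the casualties to A and B over $(\tau_{i-1},\tau_i]$; given $\Delta_1$, the variables $X_1$ and $Y_1$ are conditionally independent with $E[u^{X_1}\mid\Delta_1]=e^{\lambda\Delta_1(u-1)}$ and $E[v^{Y_1}\mid\Delta_1]=e^{\mu\Delta_1(v-1)}$. Let $A_k=X_0+X_1+\dots+X_k$ and $B_k=Y_0+Y_1+\dots+Y_k$, where $X_0,Y_0$ are the initial casualties, let $M$ and $N$ (positive real numbers) be the thresholds of A and B, and put $$\nu_1=\inf\{j\ge 0: A_j\ge M\},\qquad \nu_2=\inf\{k\ge 0: B_k\ge N\},\qquad \rho=\min\{\nu_1,\nu_2\}.$$ Then the joint functional $$\varPhi(u,v,\theta)=E\left[u^{A_\rho}v^{B_\rho}e^{-\theta\tau_\rho}\right],\qquad |u|\le1,\ |v|\le1,\ \operatorname{Re}\theta\ge0,$$ satisfies $$\varPhi(u,v,\theta)=\frac{\gamma}{\gamma+\lambda(1-u)+\mu(1-v)+\theta}\left(1-\frac{\lambda(1-u)+\mu(1-v)+\theta}{\lambda+\mu(1-v)+\theta}\,\psi\right),$$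 where $$\psi=\frac{1-b^M}{1-b}-\frac{1}{1-b}\,C^N\sum_{j=0}^{M-1}\binom{N+j-1}{j}\left[a^j-b^M\left(\frac{a}{b}\right)^j\right],$$ $$a=\frac{\lambda u}{\lambda+\mu+\theta},\qquad b=\frac{\lambda u}{\lambda+\mu+\theta-\mu v},\qquad C=\frac{\mu v}{\lambda+\mu+\theta}.$$
   Context: Interpretation: $A_k$ and $B_k$ are the cumulative damages to players A and B by the observation time $\tau_k$, and $\tau_\rho$ is the observed first passage (ruin, exit) time, i.e. the first observation epoch at which the cumulative damage to A is at least $M$ or that to B is at least $N$. In this setting $E[u^{X_1}v^{Y_1}e^{-\theta\tau_1}]=\dfrac{\gamma}{\gamma+\lambda(1-u)+\mu(1-v)+\theta}$.
   Formalization: For non-integer M, N the printed ψ (sum to M−1, binomials, powers b^M, C^N) is ill-defined; in ψ, M and N are replaced by their ceilings, which changes nothing for integers. At u=v=1, θ=0 the term with ψ is read as 0, and at u=0 the term b^M(a/b)^j is read as 0. *)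

theory Defs
  imports "HOL-Probability.Probability"
begin

text \<open>
  Sequences of attack times, damages and inter-observation times are indexed from 1;
  their value at index 0 is never used.
\<close>

text \<open>The value on \<open>S\<close> of the random measure \<open>\<Sum>j\<ge>1. w j \<cdot> \<epsilon>(s j)\<close>. It is only
  used for bounded \<open>S\<close>, where almost surely finitely many \<open>s j\<close> lie in \<open>S\<close>.\<close>

definition point_mass ::
  "(nat \<Rightarrow> 'w \<Rightarrow> real) \<Rightarrow> (nat \<Rightarrow> 'w \<Rightarrow> nat) \<Rightarrow> real set \<Rightarrow> 'w \<Rightarrow> nat" where
  "point_mass s w S \<omega> = (\<Sum>j | 1 \<le> j \<and> s j \<omega> \<in> S. w j \<omega>)"

definition poisson_process ::
  "'w measure \<Rightarrow> real \<Rightarrow> (nat \<Rightarrow> 'w \<Rightarrow> real) \<Rightarrow> (nat \<Rightarrow> 'w \<Rightarrow> nat) \<Rightarrow> bool" where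
  "poisson_process P r s w \<longleftrightarrow>
     (\<forall>j\<ge>1. s j \<in> borel_measurable P) \<and>
     (\<forall>j\<ge>1. w j \<in> measurable P (count_space UNIV)) \<and>
     (AE \<omega> in P. 0 < s 1 \<omega> \<and> strict_mono_on {1..} (\<lambda>j. s j \<omega>) \<and>
        filterlim (\<lambda>j. s j \<omega>) at_top sequentially) \<and>
     (\<forall>x y. 0 \<le> x \<and> x < y \<longrightarrow>
        distr P (count_space UNIV) (point_mass s w {x<..y}) =
          measure_pmf (poisson_pmf (r * (y - x)))) \<and>
     (\<forall>(n::nat) x. 0 \<le> x 0 \<and> (\<forall>i<n. x i < x (Suc i)) \<longrightarrow>
        prob_space.indep_vars P (\<lambda>_. count_space UNIV)
          (\<lambda>i. point_mass s w {x i<..x (Suc i)}) {..<n})"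

definition renewal_exponential ::
  "'w measure \<Rightarrow> real \<Rightarrow> (nat \<Rightarrow> 'w \<Rightarrow> real) \<Rightarrow> bool" where
  "renewal_exponential P r D \<longleftrightarrow>
     prob_space.indep_vars P (\<lambda>_. borel) D {1..} \<and>
     (\<forall>i\<ge>1. distributed P lborel (D i) (exponential_density r))"

text \<open>A marked point process and an observation process, each as a single random
  element of a sequence space.\<close>

definition point_space :: "(nat \<Rightarrow> real \<times> nat) measure" where
  "point_space = PiM {1..} (\<lambda>_. borel \<Otimes>\<^sub>M count_space UNIV)"

definition points ::
  "(nat \<Rightarrow> 'w \<Rightarrow> real) \<Rightarrow> (nat \<Rightarrow> 'w \<Rightarrow> nat) \<Rightarrow> 'w \<Rightarrow> nat \<Rightarrow> real \<times> nat" where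
  "points s w \<omega> = (\<lambda>j\<in>{1..}. (s j \<omega>, w j \<omega>))"

definition times_space :: "(nat \<Rightarrow> real) measure" where
  "times_space = PiM {1..} (\<lambda>_. borel)"

definition times_seq :: "(nat \<Rightarrow> 'w \<Rightarrow> real) \<Rightarrow> 'w \<Rightarrow> nat \<Rightarrow> real" where
  "times_seq D \<omega> = (\<lambda>i\<in>{1..}. D i \<omega>)"

text \<open>The library's \<open>indep_var\<close> forces both random elements to have the same value type.\<close>

definition indep_elements ::
  "'w measure \<Rightarrow> 'x measure \<Rightarrow> ('w \<Rightarrow> 'x) \<Rightarrow> 'y measure \<Rightarrow> ('w \<Rightarrow> 'y) \<Rightarrow> bool" where
  "indep_elements P K X L Y \<longleftrightarrow>
     X \<in> measurable P K \<and> Y \<in> measurable P L \<and>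
     prob_space.indep_set P (sets (vimage_algebra (space P) X K))
       (sets (vimage_algebra (space P) Y L))"

definition epoch :: "(nat \<Rightarrow> 'w \<Rightarrow> real) \<Rightarrow> nat \<Rightarrow> 'w \<Rightarrow> real" where
  "epoch D k \<omega> = (\<Sum>i=1..k. D i \<omega>)"

text \<open>The initial casualties are the mass at time \<open>epoch D 0 = 0\<close>; they vanish almost
  surely for a process whose first attack time is positive.\<close>

definition casualties ::
  "(nat \<Rightarrow> 'w \<Rightarrow> real) \<Rightarrow> (nat \<Rightarrow> 'w \<Rightarrow> nat) \<Rightarrow> (nat \<Rightarrow> 'w \<Rightarrow> real) \<Rightarrow> nat \<Rightarrow> 'w \<Rightarrow> nat" where
  "casualties s w D i \<omega> =
     (if i = 0 then point_mass s w {0} \<omega>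
      else point_mass s w {epoch D (i - 1) \<omega><..epoch D i \<omega>} \<omega>)"

definition cum_damage ::
  "(nat \<Rightarrow> 'w \<Rightarrow> real) \<Rightarrow> (nat \<Rightarrow> 'w \<Rightarrow> nat) \<Rightarrow> (nat \<Rightarrow> 'w \<Rightarrow> real) \<Rightarrow> nat \<Rightarrow> 'w \<Rightarrow> nat" where
  "cum_damage s w D k \<omega> = (\<Sum>i\<le>k. casualties s w D i \<omega>)"

definition passage_index :: "(nat \<Rightarrow> 'w \<Rightarrow> nat) \<Rightarrow> real \<Rightarrow> 'w \<Rightarrow> enat" where
  "passage_index A M \<omega> = (INF j\<in>{j. M \<le> real (A j \<omega>)}. enat j)"

definition exit_index ::
  "(nat \<Rightarrow> 'w \<Rightarrow> nat) \<Rightarrow> (nat \<Rightarrow> 'w \<Rightarrow> nat) \<Rightarrow> real \<Rightarrow> real \<Rightarrow> 'w \<Rightarrow> enat" where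
  "exit_index A B M N \<omega> = min (passage_index A M \<omega>) (passage_index B N \<omega>)"

text \<open>The event that the exit index is infinite is null in the model, so the value of
  \<open>the_enat \<infinity>\<close> does not matter.\<close>

definition exit_functional ::
  "'w measure \<Rightarrow> (nat \<Rightarrow> 'w \<Rightarrow> nat) \<Rightarrow> (nat \<Rightarrow> 'w \<Rightarrow> nat) \<Rightarrow> (nat \<Rightarrow> 'w \<Rightarrow> real) \<Rightarrow>
    real \<Rightarrow> real \<Rightarrow> complex \<Rightarrow> complex \<Rightarrow> complex \<Rightarrow> complex" where
  "exit_functional P A B \<tau> M N u v \<theta> =
     (LINT \<omega>|P. (let k = the_enat (exit_index A B M N \<omega>)
        in u ^ A k \<omega> * v ^ B k \<omega> * exp (- \<theta> * complex_of_real (\<tau> k \<omega>))))"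

text \<open>For \<open>m, n > 0\<close>, positive rates, \<open>norm u, norm v \<le> 1\<close> and \<open>Re \<theta> \<ge> 0\<close>, division by
  zero can occur here only at \<open>u = 0\<close>, where \<open>b ^ m = 0\<close> kills the term with \<open>a / b\<close>, and at
  \<open>u = v = 1\<close>, \<open>\<theta> = 0\<close>, where the factor multiplying \<open>psi\<close> in the exit functional is 0.\<close>

definition psi ::
  "real \<Rightarrow> real \<Rightarrow> nat \<Rightarrow> nat \<Rightarrow> complex \<Rightarrow> complex \<Rightarrow> complex \<Rightarrow> complex" where
  "psi lam \<mu> m n u v \<theta> =
     (let a = lam * u / (lam + \<mu> + \<theta>);
          b = lam * u / (lam + \<mu> + \<theta> - \<mu> * v);
          C = \<mu> * v / (lam + \<mu> + \<theta>)
      in (1 - b ^ m) / (1 - b) -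
         1 / (1 - b) * C ^ n *
           (\<Sum>j<m. of_nat ((n + j - 1) choose j) * (a ^ j - b ^ m * (a / b) ^ j)))"

end

theory Submission
  imports Defs "HOL-Real_Asymp.Real_Asymp"
begin

text \<open>
  Put \<open>D = \<lambda> + \<mu> + \<theta>\<close>, \<open>K = \<lambda>(1 - u) + \<mu>(1 - v) + \<theta>\<close> and \<open>Z\<^sub>k = u\<^sup>A v\<^sup>B exp (- \<theta> \<tau>\<^sub>k)\<close>, with \<open>A\<close> and \<open>B\<close> the
  damages at the \<open>k\<close>-th epoch. The increments over one observation period are independent of the
  past and contribute the factor \<open>g = \<gamma> / (\<gamma> + K)\<close>, so telescoping \<open>Z\<close> up to the exit index \<open>\<rho>\<close>
  gives \<open>E Z\<^sub>\<rho> = 1 - (1 - g) S\<close> with \<open>S = \<Sum>k. E (Z\<^sub>k; k < \<rho>)\<close>. Since damages only grow, \<open>k < \<rho>\<close>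
  means that at epoch \<open>k\<close> both damages are below the thresholds, rounded up to integers \<open>m\<close> and \<open>n\<close>.
  The epochs after time 0 have renewal density \<open>\<gamma>\<close>, so the terms of \<open>S\<close> with \<open>k > 0\<close> add up to
  Laplace transforms of powers, which yields \<open>S = 1 + \<gamma> / D * T\<close> with
  \<open>T = \<Sum>p<m. \<Sum>q<n. (p + q choose p) (\<lambda>u / D)\<^sup>p (\<mu>v / D)\<^sup>q\<close>. A partial-sum version of the
  negative binomial series turns \<open>(1 - \<mu>v / D) T\<close> into \<open>\<psi>\<close>.
\<close>

section \<open>Binomial sums and Laplace transforms\<close>

text \<open>For a success probability C, the left side is the chance that fewer than n successes
  precede failure number m + 1. The right side is the complement: success number n comes after some
  j \<le> m failures. As a polynomial identity it holds in any commutative ring, by induction on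
  m.\<close>

lemma negative_binomial_partial_sum:
  fixes C :: "'a :: comm_ring_1"
  assumes "0 < n"
  shows "(1 - C) ^ Suc m * (\<Sum>q<n. of_nat ((m + q) choose m) * C ^ q) =
    1 - C ^ n * (\<Sum>j\<le>m. of_nat ((n + j - 1) choose j) * (1 - C) ^ j)"
proof (induction m)
  case 0
  show ?case
    by (simp add: one_diff_power_eq)
next
  case (Suc m)
  define U where "U m = (\<Sum>q<n. of_nat ((m + q) choose m) * C ^ q)" for m
  obtain n' where n: "n = Suc n'"
    using assms by (cases n) auto
  \<comment> \<open>Pascal's rule splits each coefficient in two. In the second sum the term q = 0
    vanishes, so an index shift pulls out one factor C and shortens the range to n'.\<close>
  have pascal: "U (Suc m) = U m + C * (\<Sum>q<n'. of_nat ((Suc m + q) choose Suc m) * C ^ q)"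
  proof -
    have "U (Suc m) =
      (\<Sum>q<n. of_nat ((m + q) choose m) * C ^ q) + (\<Sum>q<n. of_nat ((m + q) choose Suc m) * C ^ q)"
      by (simp add: U_def sum.distrib[symmetric] algebra_simps)
    also have "(\<Sum>q<n. of_nat ((m + q) choose Suc m) * C ^ q) =
        C * (\<Sum>q<n'. of_nat ((Suc m + q) choose Suc m) * C ^ q)"
      unfolding n sum.lessThan_Suc_shift by (simp add: sum_distrib_left binomial_eq_0 algebra_simps)
    finally show ?thesis
      by (simp add: U_def)
  qed
  define W where "W = (\<Sum>q<n'. of_nat ((Suc m + q) choose Suc m) * C ^ q)"
  define k :: 'a where "k = of_nat ((n + m) choose Suc m)"
  \<comment> \<open>Splitting off the last term gives a second expression for
    \<open>U (Suc m)\<close> in terms of W. Eliminating W leaves a recursion from m to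
    \<open>Suc m\<close> with the single correction k C^n.\<close>
  have "U (Suc m) = W + k * C ^ n'"
    by (simp add: U_def W_def k_def n add.commute)
  moreover have "U (Suc m) = U m + C * W"
    using pascal by (simp add: W_def)
  ultimately have "(1 - C) * U (Suc m) = U m - k * C ^ n"
    by (simp add: n) (simp add: algebra_simps)
  then have "(1 - C) ^ Suc (Suc m) * U (Suc m) =
      (1 - C) ^ Suc m * U m - (1 - C) ^ Suc m * (k * C ^ n)"
    by (subst right_diff_distrib[symmetric]) (simp only: power_Suc2 mult.assoc)
  also have "(1 - C) ^ Suc m * U m = 1 - C ^ n * (\<Sum>j\<le>m. of_nat ((n + j - 1) choose j) * (1 - C) ^ j)"
    unfolding U_def by (rule Suc.IH)
  finally show ?case
    unfolding U_def[symmetric] sum.atMost_Suc by (simp add: k_def distrib_left mult_ac)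
qed

text \<open>Because a = b (1 - C), row p of the double sum times 1 - C is b^p times the left side of
  \<open>negative_binomial_partial_sum\<close>. The rows then form a geometric sum in b, which the
  factor 1 - b collapses. The form without division lets the induction on m run in a ring.\<close>

lemma binomial_double_sum:
  fixes a b C :: "'a :: comm_ring_1"
  assumes "0 < n" and a: "a = b * (1 - C)"
  shows "(1 - b) * ((1 - C) * (\<Sum>p<m. \<Sum>q<n. of_nat ((p + q) choose p) * a ^ p * C ^ q)) =
    1 - b ^ m - C ^ n * (\<Sum>j<m. of_nat ((n + j - 1) choose j) * (a ^ j - b ^ m * (1 - C) ^ j))"
proof (induction m)
  case 0
  then show ?case by simp
next
  case (Suc m)
  define U where "U = (\<Sum>q<n. of_nat ((m + q) choose m) * C ^ q)"
  define V where "V = (\<Sum>j<m. of_nat ((n + j - 1) choose j) * (1 - C) ^ j)"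
  define T where "T = (\<Sum>j<m. of_nat ((n + j - 1) choose j) * a ^ j)"
  define k :: 'a where "k = of_nat ((n + m - 1) choose m)"
  have U: "(1 - C) ^ Suc m * U = 1 - C ^ n * (V + k * (1 - C) ^ m)"
    using negative_binomial_partial_sum[OF assms(1), of C m]
    by (simp add: U_def V_def k_def lessThan_Suc_atMost[symmetric])
  \<comment> \<open>The coefficient x stays free because the induction step uses both x = b^m
    (hypothesis) and x = b^(m + 1) (goal).\<close>
  have sum_split: "(\<Sum>j<m. of_nat ((n + j - 1) choose j) * (a ^ j - x * (1 - C) ^ j)) = T - x * V" for x
    by (simp add: T_def V_def sum_subtractf sum_distrib_left algebra_simps)
  define S where "S = (\<Sum>p<m. \<Sum>q<n. of_nat ((p + q) choose p) * a ^ p * C ^ q)"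
  have S_Suc: "(\<Sum>p<Suc m. \<Sum>q<n. of_nat ((p + q) choose p) * a ^ p * C ^ q) = S + a ^ m * U"
    by (simp add: S_def U_def sum_distrib_left algebra_simps)
  have am: "a ^ m = b ^ m * (1 - C) ^ m"
    by (simp only: a power_mult_distrib)
  have "(1 - b) * ((1 - C) * (S + a ^ m * U)) =
      (1 - b) * ((1 - C) * S) + (1 - b) * b ^ m * ((1 - C) ^ Suc m * U)"
    by (simp add: am algebra_simps)
  also have "(1 - b) * ((1 - C) * S) = 1 - b ^ m - C ^ n * (T - b ^ m * V)"
    using Suc.IH unfolding sum_split S_def .
  also have "1 - b ^ m - C ^ n * (T - b ^ m * V) + (1 - b) * b ^ m * ((1 - C) ^ Suc m * U) =
      1 - b ^ m - C ^ n * (T - b ^ m * V) + (1 - b) * b ^ m * (1 - C ^ n * (V + k * (1 - C) ^ m))"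
    unfolding U ..
  also have "\<dots> = 1 - b ^ Suc m - C ^ n * (T - b ^ Suc m * V + k * (a ^ m - b ^ Suc m * (1 - C) ^ m))"
    by (simp add: am algebra_simps)
  finally show ?case
    unfolding S_Suc unfolding sum.lessThan_Suc sum_split k_def .
qed

text \<open>The last hypothesis says b \<noteq> 1, so that \<open>binomial_double_sum\<close> may be
  divided by 1 - b.\<close>

lemma psi_eq_binomial_sum:
  fixes u v \<theta> D :: complex
  assumes "0 < m" "0 < n"
    and D: "D = lam + \<mu> + \<theta>" "D \<noteq> 0" and "D - \<mu> * v \<noteq> 0" and "D - \<mu> * v \<noteq> lam * u"
  shows "psi lam \<mu> m n u v \<theta> =
    (1 - \<mu> * v / D) * (\<Sum>p<m. \<Sum>q<n. of_nat ((p + q) choose p) * (lam * u / D) ^ p * (\<mu> * v / D) ^ q)"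
proof -
  define a where "a = lam * u / D"
  define b where "b = lam * u / (D - \<mu> * v)"
  define C where "C = \<mu> * v / D"
  have C: "1 - C \<noteq> 0" "1 - C = (D - \<mu> * v) / D"
    using assms by (auto simp: C_def field_simps)
  have b: "1 - b \<noteq> 0"
    using assms by (auto simp: b_def field_simps)
  have a: "a = b * (1 - C)"
    using assms by (simp add: a_def b_def C)
  \<comment> \<open>For b = 0 the quotient a / b is 0 by convention and may differ from 1 - C, but
    then b^m = 0 because m is positive.\<close>
  have ab: "b ^ m * (a / b) ^ j = b ^ m * (1 - C) ^ j" for j
    using \<open>0 < m\<close> by (cases "b = 0") (auto simp: a)
  have "psi lam \<mu> m n u v \<theta> = (1 - b ^ m - C ^ n *
      (\<Sum>j<m. of_nat ((n + j - 1) choose j) * (a ^ j - b ^ m * (1 - C) ^ j))) / (1 - b)"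
    unfolding psi_def D(1)[symmetric] Let_def a_def[symmetric] b_def[symmetric] C_def[symmetric]
    by (simp add: ab diff_divide_distrib)
  also have "\<dots> = (1 - C) * (\<Sum>p<m. \<Sum>q<n. of_nat ((p + q) choose p) * a ^ p * C ^ q)"
    using binomial_double_sum[OF \<open>0 < n\<close> a, of m] b by (simp add: field_simps)
  finally show ?thesis
    by (simp add: a_def C_def)
qed

text \<open>\<open>erlang_density k l\<close> is the density of epoch k + 1 of a renewal process
  with exponential gaps. The sum is its renewal density, constant because the exponential series
  cancels exp (- l x).\<close>

lemma sums_erlang_density:
  assumes "0 \<le> x"
  shows "(\<lambda>k. erlang_density k l x) sums l"
proof -
  have "(\<lambda>k. l * exp (- l * x) * ((l * x) ^ k /\<^sub>R fact k)) sums (l * exp (- l * x) * exp (l * x))"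
    by (intro sums_mult exp_converges)
  also have "l * exp (- l * x) * exp (l * x) = l"
    by (simp add: exp_minus)
  also have "(\<lambda>k. l * exp (- l * x) * ((l * x) ^ k /\<^sub>R fact k)) = (\<lambda>k. erlang_density k l x)"
    using assms by (auto simp: erlang_density_def field_simps power_mult_distrib)
  finally show ?thesis .
qed

text \<open>Integration by parts in derivative form: the second term carries the lowered exponent.
  At n = 0 its coefficient vanishes, so the truncated n - 1 is harmless.\<close>

lemma has_vector_derivative_power_exp:
  fixes D :: complex
  assumes "D \<noteq> 0"
  shows "((\<lambda>x. - (of_real x ^ n * exp (- D * of_real x) / D)) has_vector_derivative
    (of_real x ^ n * exp (- D * of_real x) - of_nat n / D * (of_real x ^ (n - 1) * exp (- D * of_real x)))) (at x)"
proof -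
  have "((\<lambda>z. - (z ^ n * exp (- D * z) / D)) has_field_derivative
    (of_real x ^ n * exp (- D * of_real x) - of_nat n / D * (of_real x ^ (n - 1) * exp (- D * of_real x))))
    (at (of_real x))"
    using assms by (auto intro!: derivative_eq_intros simp: field_simps)
  then show ?thesis
    by (rule has_vector_derivative_real_field)
qed

text \<open>On the half-line the norm of the integrand is a multiple of the Erlang density of rate
  Re D, whose zeroth moment is 1.\<close>

lemma set_integrable_power_exp:
  fixes D :: complex
  assumes "0 < Re D"
  shows "set_integrable lborel {0<..} (\<lambda>x. of_real x ^ n * exp (- D * of_real x))"
proof -
  define l where "l = Re D"
  have "(\<integral>\<^sup>+ x. ennreal (erlang_density n l x) \<partial>lborel) = 1"
    using nn_integral_erlang_ith_moment[of l n 0] assms by (simp add: l_def)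
  then have "integrable lborel (erlang_density n l)"
    using assms by (intro integrableI_nonneg) (auto simp: l_def)
  then have "integrable lborel (\<lambda>x. fact n / l ^ Suc n * erlang_density n l x)"
    by simp
  then show ?thesis
    unfolding set_integrable_def
    by (rule Bochner_Integration.integrable_bound)
       (use assms in \<open>auto simp: l_def erlang_density_def norm_mult norm_power field_simps
          split: split_indicator\<close>)
qed

lemma laplace_transform_power:
  fixes D :: complex
  assumes "0 < Re D"
  shows "(LBINT x:{0<..}. of_real x ^ n * exp (- D * of_real x)) = fact n / D ^ Suc n"
proof -
  have D: "D \<noteq> 0"
    using assms by auto
  define f where "f n x = of_real x ^ n * exp (- D * of_real x)" for n and x :: real
  have int: "set_integrable lborel {0<..} (f n)" for n
    unfolding f_def using set_integrable_power_exp[OF assms] by simp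
  have lim: "(f n \<longlongrightarrow> 0) at_top" for n
  proof (rule tendsto_norm_zero_cancel)
    define l where "l = Re D"
    have "((\<lambda>x. x ^ n * exp (- l * x)) \<longlongrightarrow> 0) at_top"
      using assms unfolding l_def[symmetric] by real_asymp
    also have "?this \<longleftrightarrow> ((\<lambda>x. norm (f n x)) \<longlongrightarrow> 0) at_top"
      by (intro filterlim_cong refl eventually_mono[OF eventually_ge_at_top[of 0]])
        (auto simp: f_def l_def norm_mult norm_power)
    finally show "((\<lambda>x. norm (f n x)) \<longlongrightarrow> 0) at_top" .
  qed
  \<comment> \<open>The boundary term at infinity vanishes by \<open>lim\<close>. The one at 0 is
    0^n / D, which survives only for n = 0.\<close>
  have step: "(LBINT x:{0<..}. f n x - of_nat n / D * f (n - 1) x) = (if n = 0 then 1 / D else 0)" for n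
  proof -
    define F where "F x = - (f n x / D)" for x
    have "(LBINT x=0..\<infinity>. f n x - of_nat n / D * f (n - 1) x) = 0 - F 0"
    proof (rule interval_integral_FTC_integrable)
      show "(F has_vector_derivative f n x - of_nat n / D * f (n - 1) x) (at x)" for x
        using has_vector_derivative_power_exp[OF D, of n x] by (simp add: F_def[abs_def] f_def)
      show "isCont (\<lambda>x. f n x - of_nat n / D * f (n - 1) x) x" for x
        unfolding f_def by (intro continuous_intros) (use D in auto)
      show "set_integrable lborel (einterval 0 \<infinity>) (\<lambda>x. f n x - of_nat n / D * f (n - 1) x)"
        unfolding zero_ereal_def einterval_eq by (intro set_integral_diff set_integrable_mult_right int)
      have "isCont F 0"
        unfolding F_def f_def by (intro continuous_intros) (use D in auto)
      then show "((F \<circ> real_of_ereal) \<longlongrightarrow> F 0) (at_right 0)"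
        unfolding zero_ereal_def ereal_tendsto_simps1
        by (auto simp: isCont_def intro: tendsto_within_subset)
      show "((F \<circ> real_of_ereal) \<longlongrightarrow> 0) (at_left \<infinity>)"
        unfolding ereal_tendsto_simps1 F_def using tendsto_minus[OF tendsto_divide[OF lim[of n] tendsto_const D]]
        by simp
    qed simp
    then show ?thesis
      using interval_integral_to_infinity_eq[where a = 0 and M = lborel and f = "\<lambda>x. f n x - of_nat n / D * f (n - 1) x"]
      by (cases n) (simp_all add: F_def f_def zero_ereal_def)
  qed
  have "(LBINT x:{0<..}. f n x) = fact n / D ^ Suc n"
  proof (induction n)
    case 0
    then show ?case using step[of 0] by simp
  next
    case (Suc n)
    have "(LBINT x:{0<..}. f (Suc n) x) = of_nat (Suc n) / D * (LBINT x:{0<..}. f n x)"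
      using step[of "Suc n"] int by (simp add: set_integral_diff set_integrable_mult_right del: of_nat_Suc)
    then show ?case
      unfolding Suc.IH by (simp add: field_simps)
  qed
  then show ?thesis
    by (simp add: f_def)
qed

section \<open>Counting functions of unit-mass Poisson processes\<close>

text \<open>For strictly increasing times tending to infinity this is the number of indices j \<ge>
  1 with time at most x. It acts on the sequence space instead of the sample space, so that
  independence of \<open>points s w\<close> carries over to it. Masses do not enter, being 1 almost
  surely in the application.\<close>

definition count_upto :: "(nat \<Rightarrow> real \<times> nat) \<Rightarrow> real \<Rightarrow> nat" where
  "count_upto \<xi> x = (LEAST j. x < fst (\<xi> (Suc j)))"

lemma le_count_upto_iff:
  assumes mono: "strict_mono_on {1..} (\<lambda>j. fst (\<xi> j))"
    and lim: "filterlim (\<lambda>j. fst (\<xi> j)) at_top sequentially" and "1 \<le> j"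
  shows "j \<le> count_upto \<xi> x \<longleftrightarrow> fst (\<xi> j) \<le> x"
proof -
  define c where "c = count_upto \<xi> x"
  have "eventually (\<lambda>j. x < fst (\<xi> j)) sequentially"
    using lim by (simp add: filterlim_at_top_dense)
  then obtain k where "x < fst (\<xi> (Suc k))"
    by (auto simp: eventually_sequentially intro: le_SucI)
  then have c: "x < fst (\<xi> (Suc c))"
    unfolding c_def count_upto_def by (rule LeastI)
  have below: "fst (\<xi> (Suc i)) \<le> x" if "i < c" for i
    using not_less_Least[of i "\<lambda>j. x < fst (\<xi> (Suc j))"] that by (simp add: c_def count_upto_def)
  have "fst (\<xi> (Suc c)) \<le> fst (\<xi> j)" if "\<not> j \<le> c"
    using strict_mono_onD[OF mono, of "Suc c" j] that by (cases "j = Suc c") auto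
  with c below[of "j - 1"] \<open>1 \<le> j\<close> show ?thesis
    unfolding c_def[symmetric] by (cases "j \<le> c") auto
qed

text \<open>The time is a random variable here because the counts are later evaluated at random
  epochs.\<close>

lemma measurable_count_upto [measurable]:
  assumes [measurable]: "X \<in> measurable M point_space" "T \<in> borel_measurable M"
  shows "(\<lambda>\<omega>. count_upto (X \<omega>) (T \<omega>)) \<in> measurable M (count_space UNIV)"
proof -
  have [measurable]: "(\<lambda>\<omega>. X \<omega> (Suc j)) \<in> measurable M (borel \<Otimes>\<^sub>M count_space UNIV)" for j
    using measurable_compose[OF assms(1)[unfolded point_space_def]
      measurable_component_singleton[of "Suc j" "{1..}"]] by simp
  show ?thesis
    unfolding count_upto_def by measurable
qed

section \<open>Measurability of point masses of random sets\<close>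

lemma measurable_nat_add [measurable (raw)]:
  fixes f g :: "'a \<Rightarrow> nat"
  assumes "f \<in> measurable M (count_space UNIV)" "g \<in> measurable M (count_space UNIV)"
  shows "(\<lambda>x. f x + g x) \<in> measurable M (count_space UNIV)"
  by (rule measurable_compose_countable[where f="\<lambda>i x. i + g x", OF _ assms(1)])
    (rule measurable_compose[OF assms(2)], simp)

lemma measurable_nat_sum [measurable (raw)]:
  fixes f :: "'i \<Rightarrow> 'a \<Rightarrow> nat"
  assumes "\<And>i. i \<in> I \<Longrightarrow> f i \<in> measurable M (count_space UNIV)"
  shows "(\<lambda>x. \<Sum>i\<in>I. f i x) \<in> measurable M (count_space UNIV)"
  using assms by (induction I rule: infinite_finite_induct) (auto intro!: measurable_nat_add)

lemma measurable_point_mass: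
  assumes S: "\<And>j. 1 \<le> j \<Longrightarrow> Measurable.pred M (\<lambda>\<omega>. s j \<omega> \<in> S \<omega>)"
    and w: "\<And>j. 1 \<le> j \<Longrightarrow> w j \<in> measurable M (count_space UNIV)"
  shows "(\<lambda>\<omega>. point_mass s w (S \<omega>) \<omega>) \<in> measurable M (count_space UNIV)"
proof -
  define I where "I j \<omega> \<longleftrightarrow> 1 \<le> j \<and> s j \<omega> \<in> S \<omega>" for j \<omega>
  have I [measurable]: "Measurable.pred M (I j)" for j
    using S[of j] by (cases "1 \<le> j") (simp_all add: I_def[abs_def])
  define B where "B K \<omega> \<longleftrightarrow> (\<forall>j\<ge>K. \<not> I j \<omega>)" for K \<omega>
  have [measurable]: "Measurable.pred M (B K)" for K
    unfolding B_def by measurable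
  define F where "F K \<omega> = (\<Sum>j<K. if I j \<omega> then w j \<omega> else 0)" for K \<omega>
  have F: "F K \<in> measurable M (count_space UNIV)" for K
    unfolding F_def
  proof (rule measurable_nat_sum)
    show "(\<lambda>\<omega>. if I j \<omega> then w j \<omega> else 0) \<in> measurable M (count_space UNIV)" for j
    proof (cases "1 \<le> j")
      case True
      show ?thesis
        by (intro measurable_If w True) (use I[of j] in \<open>simp_all add: pred_def\<close>)
    qed (simp add: I_def)
  qed
  \<comment> \<open>If the selected indices are bounded, the mass is a finite sum up to the least
    bound K. If they are not, the index set is infinite and \<open>sum\<close> takes its default
    value 0.\<close>
  have "point_mass s w (S \<omega>) \<omega> = (if \<exists>K. B K \<omega> then F (LEAST K. B K \<omega>) \<omega> else 0)" for \<omega>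
  proof (cases "\<exists>K. B K \<omega>")
    case True
    define K where "K = (LEAST K. B K \<omega>)"
    have "B K \<omega>"
      unfolding K_def using True by (rule LeastI_ex)
    then have "{j. I j \<omega>} = {j \<in> {..<K}. I j \<omega>}"
      by (auto simp: B_def) (meson not_le)
    then have "point_mass s w (S \<omega>) \<omega> = F K \<omega>"
      unfolding point_mass_def I_def[symmetric] F_def
      by (simp only: sum.inter_filter[OF finite_lessThan])
    with True show ?thesis
      by (simp add: K_def)
  next
    case False
    then have "infinite {j. I j \<omega>}"
      unfolding B_def infinite_nat_iff_unbounded_le by blast
    with False show ?thesis
      unfolding point_mass_def I_def[symmetric] by simp
  qed
  moreover have "(\<lambda>\<omega>. F (LEAST K. B K \<omega>) \<omega>) \<in> measurable M (count_space UNIV)"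
    by (rule measurable_compose_countable[OF F]) measurable
  ultimately show ?thesis
    by simp
qed

lemma integral_poisson_power:
  fixes u :: complex
  assumes "0 < l"
  shows "(\<integral>k. u ^ k \<partial>measure_pmf (poisson_pmf l)) = exp (l * (u - 1))"
proof -
  have sum: "(\<lambda>k. exp (- of_real l) * ((l * u) ^ k /\<^sub>R fact k)) sums (exp (- of_real l) * exp (l * u))"
    by (intro sums_mult exp_converges)
  have eq: "pmf (poisson_pmf l) k *\<^sub>R u ^ k = exp (- of_real l) * ((l * u) ^ k /\<^sub>R fact k)" for k
    using assms by (simp add: scaleR_conv_of_real exp_of_real[symmetric] power_mult_distrib field_simps
        del: exp_of_real)
  have "summable (\<lambda>k. norm (exp (- of_real l) * ((l * u) ^ k /\<^sub>R fact k)))"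
    unfolding norm_mult by (intro summable_mult summable_norm_exp)
  then have "integrable (count_space UNIV) (\<lambda>k. pmf (poisson_pmf l) k *\<^sub>R u ^ k)"
    unfolding eq integrable_count_space_nat_iff .
  then have "(\<integral>k. pmf (poisson_pmf l) k *\<^sub>R u ^ k \<partial>count_space UNIV) = exp (- of_real l) * exp (l * u)"
    using sums_unique[OF sum] by (simp add: integral_count_space_nat eq)
  then show ?thesis
    by (simp add: measure_pmf_eq_density integral_density mult_exp_exp algebra_simps)
qed

text \<open>For a unit-mass Poisson process with counting function \<open>K\<close>, this is the value of
  \<open>E [K x = p] u ^ K y\<close> for \<open>0 \<le> x \<le> y\<close>.\<close>

definition count_transform :: "real \<Rightarrow> complex \<Rightarrow> nat \<Rightarrow> real \<Rightarrow> real \<Rightarrow> complex" where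
  "count_transform r u p x y =
     u ^ p * complex_of_real ((r * x) ^ p / fact p * exp (- r * x)) * exp (r * (u - 1) * complex_of_real (y - x))"

lemma borel_measurable_count_transform [measurable]:
  assumes [measurable]: "f \<in> borel_measurable M" "g \<in> borel_measurable M"
  shows "(\<lambda>x. count_transform r u p (f x) (g x)) \<in> borel_measurable M"
  unfolding count_transform_def by measurable

section \<open>Counts of a single Poisson process at fixed times\<close>

locale unit_poisson_process = prob_space P for P :: "'w measure" +
  fixes r :: real and s :: "nat \<Rightarrow> 'w \<Rightarrow> real" and w :: "nat \<Rightarrow> 'w \<Rightarrow> nat"
  assumes rate_pos: "0 < r" and poisson: "poisson_process P r s w"
    and unit_mass: "\<And>j. 1 \<le> j \<Longrightarrow> AE \<omega> in P. w j \<omega> = 1"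
begin

abbreviation count :: "real \<Rightarrow> 'w \<Rightarrow> nat" where
  "count x \<omega> \<equiv> count_upto (points s w \<omega>) x"

lemma measurable_times [measurable]: "1 \<le> j \<Longrightarrow> s j \<in> borel_measurable P"
  and measurable_masses [measurable]: "1 \<le> j \<Longrightarrow> w j \<in> measurable P (count_space UNIV)"
  using poisson by (auto simp: poisson_process_def)

lemma measurable_points [measurable]: "points s w \<in> measurable P point_space"
  unfolding points_def point_space_def
  by (rule measurable_restrict) (auto intro!: measurable_Pair)

text \<open>The exceptional null set depends only on the path and its masses, so a single one serves
  all x and y. This is what allows substituting random epochs later.\<close>

lemma AE_point_mass:
  "AE \<omega> in P. point_mass s w {0} \<omega> = 0 \<and> count 0 \<omega> = 0 \<and>
     (\<forall>x y. x \<le> y \<longrightarrow> count x \<omega> \<le> count y \<omega> \<and> point_mass s w {x<..y} \<omega> = count y \<omega> - count x \<omega>)"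
proof -
  have "AE \<omega> in P. 0 < s 1 \<omega> \<and> strict_mono_on {1..} (\<lambda>j. s j \<omega>) \<and>
        filterlim (\<lambda>j. s j \<omega>) at_top sequentially"
    using poisson by (auto simp: poisson_process_def)
  moreover have "AE \<omega> in P. \<forall>j. 1 \<le> j \<longrightarrow> w j \<omega> = 1"
    using unit_mass by (auto simp: AE_all_countable)
  ultimately show ?thesis
  proof eventually_elim
    case (elim \<omega>)
    define \<xi> where "\<xi> = points s w \<omega>"
    have \<xi>: "fst (\<xi> j) = s j \<omega>" if "1 \<le> j" for j
      using that by (simp add: \<xi>_def points_def)
    have "strict_mono_on {1..} (\<lambda>j. fst (\<xi> j))"
      using elim(1) \<xi> by (auto simp: strict_mono_on_def)
    moreover have "filterlim (\<lambda>j. fst (\<xi> j)) at_top sequentially"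
    proof -
      have "eventually (\<lambda>j. fst (\<xi> j) = s j \<omega>) sequentially"
        using \<xi> by (rule eventually_sequentiallyI)
      with elim show ?thesis
        using filterlim_cong[OF refl refl, of "\<lambda>j. fst (\<xi> j)" "\<lambda>j. s j \<omega>"] by blast
    qed
    ultimately have iff: "j \<le> count_upto \<xi> x \<longleftrightarrow> s j \<omega> \<le> x" if "1 \<le> j" for j x
      using le_count_upto_iff[of \<xi> j x] that by (simp add: \<xi>)
    have pos: "0 < s j \<omega>" if "1 \<le> j" for j
      using strict_mono_onD[of "{1..}" "\<lambda>j. s j \<omega>" 1 j] elim(1) that by (cases "j = 1") auto
    have "{j. 1 \<le> j \<and> s j \<omega> = 0} = {}"
      using pos by force
    then have "point_mass s w {0} \<omega> = 0"
      by (simp only: point_mass_def singleton_iff) simp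
    moreover have "count_upto \<xi> 0 = 0"
      using iff[of 1 0] pos[of 1] by simp
    moreover have "count_upto \<xi> x \<le> count_upto \<xi> y" if "x \<le> y" for x y
      using iff[of "count_upto \<xi> x" x] iff[of "count_upto \<xi> x" y] that
      by (cases "count_upto \<xi> x = 0") auto
    moreover have "point_mass s w {x<..y} \<omega> = count_upto \<xi> y - count_upto \<xi> x" for x y
    proof -
      have "{j. 1 \<le> j \<and> s j \<omega> \<in> {x<..y}} = {count_upto \<xi> x<..count_upto \<xi> y}"
      proof (rule set_eqI)
        show "j \<in> {j. 1 \<le> j \<and> s j \<omega> \<in> {x<..y}} \<longleftrightarrow> j \<in> {count_upto \<xi> x<..count_upto \<xi> y}" for j
          using iff[of j x] iff[of j y] by (cases "1 \<le> j") auto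
      qed
      moreover have "(\<Sum>j\<in>{count_upto \<xi> x<..count_upto \<xi> y}. w j \<omega>) = (\<Sum>j\<in>{count_upto \<xi> x<..count_upto \<xi> y}. 1)"
        using elim(2) by (intro sum.cong) auto
      ultimately show ?thesis
        by (simp add: point_mass_def)
    qed
    ultimately show ?case
      unfolding \<xi>_def[symmetric] by blast
  qed
qed

lemma measurable_point_mass_interval [measurable]:
  "point_mass s w {x<..y} \<in> measurable P (count_space UNIV)"
proof (rule measurable_point_mass)
  fix j :: nat assume j [simp]: "1 \<le> j"
  note [measurable] = measurable_times[OF j]
  show "Measurable.pred P (\<lambda>\<omega>. s j \<omega> \<in> {x<..y})"
    unfolding greaterThanAtMost_iff by measurable
qed (rule measurable_masses)

lemma expectation_increment:
  fixes f :: "nat \<Rightarrow> complex"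
  assumes "0 \<le> x" "x < y"
  shows "expectation (\<lambda>\<omega>. f (point_mass s w {x<..y} \<omega>)) = (\<integral>k. f k \<partial>measure_pmf (poisson_pmf (r * (y - x))))"
proof -
  have "distr P (count_space UNIV) (point_mass s w {x<..y}) = measure_pmf (poisson_pmf (r * (y - x)))"
    using poisson assms by (auto simp: poisson_process_def)
  then show ?thesis
    using integral_distr[OF measurable_point_mass_interval[of x y], of f] by simp
qed

lemma expectation_increments_mult:
  fixes f g :: "nat \<Rightarrow> complex"
  assumes "0 < x" "x < y" and f: "\<And>k. norm (f k) \<le> 1" and g: "\<And>k. norm (g k) \<le> 1"
  shows "expectation (\<lambda>\<omega>. f (point_mass s w {0<..x} \<omega>) * g (point_mass s w {x<..y} \<omega>)) =
    expectation (\<lambda>\<omega>. f (point_mass s w {0<..x} \<omega>)) * expectation (\<lambda>\<omega>. g (point_mass s w {x<..y} \<omega>))"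
proof -
  \<comment> \<open>The partition 0 < x < y, in the indexed form that the independence of increments
    in \<open>poisson_process\<close> expects.\<close>
  define e where "e i = (if i = 0 then 0 else if i = 1 then x else y)" for i :: nat
  define h where "h i = (if i = 0 then f else g)" for i :: nat
  define Z where "Z i = point_mass s w {e i<..e (Suc i)}" for i
  have "indep_vars (\<lambda>_. count_space UNIV) Z {..<2}"
  proof -
    have "0 \<le> e 0 \<and> (\<forall>i<2. e i < e (Suc i))"
      using assms by (auto simp: e_def less_Suc_eq numeral_2_eq_2)
    with poisson show ?thesis
      unfolding poisson_process_def Z_def by blast
  qed
  then have "indep_vars (\<lambda>_. borel) (\<lambda>i \<omega>. h i (Z i \<omega>)) {..<2}"
    by (rule indep_vars_compose2) simp
  moreover have "integrable P (\<lambda>\<omega>. h i (Z i \<omega>))" for i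
    by (rule integrable_const_bound[where B = 1]) (auto simp: h_def f g Z_def)
  ultimately have "expectation (\<lambda>\<omega>. \<Prod>i<2. h i (Z i \<omega>)) = (\<Prod>i<2. expectation (\<lambda>\<omega>. h i (Z i \<omega>)))"
    by (intro indep_vars_lebesgue_integral) auto
  then show ?thesis
    by (simp add: numeral_2_eq_2 h_def Z_def e_def)
qed

lemma AE_count_0: "AE \<omega> in P. count 0 \<omega> = 0"
  and AE_count_mono: "x \<le> y \<Longrightarrow> AE \<omega> in P. count x \<omega> \<le> count y \<omega>"
  and AE_count_eq: "0 \<le> x \<Longrightarrow> AE \<omega> in P. count x \<omega> = point_mass s w {0<..x} \<omega>"
  and AE_increment: "x \<le> y \<Longrightarrow> AE \<omega> in P. count y \<omega> - count x \<omega> = point_mass s w {x<..y} \<omega>"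
  by (rule eventually_mono[OF AE_point_mass], auto)+

lemma expectation_count_eq:
  assumes "0 \<le> x"
  shows "expectation (\<lambda>\<omega>. of_bool (count x \<omega> = p)) = complex_of_real ((r * x) ^ p / fact p * exp (- r * x))"
\<comment> \<open>The law of increments covers nondegenerate intervals only. At time 0 the count
  vanishes almost surely and 0^0 = 1 makes the formula agree.\<close>
proof (cases "x = 0")
  case True
  have "expectation (\<lambda>\<omega>. of_bool (count x \<omega> = p)) = expectation (\<lambda>_. of_bool (p = 0) :: complex)"
    using AE_count_0 by (intro integral_cong_AE) (auto simp: True)
  with True show ?thesis
    by (cases p) (simp_all add: prob_space)
next
  case False
  with assms have "0 < x"
    by simp
  have "expectation (\<lambda>\<omega>. of_bool (count x \<omega> = p)) =
      expectation (\<lambda>\<omega>. of_bool (point_mass s w {0<..x} \<omega> = p) :: complex)"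
    using AE_count_eq[OF assms] by (intro integral_cong_AE) auto
  also have "\<dots> = (\<integral>k. of_bool (k = p) \<partial>measure_pmf (poisson_pmf (r * x)))"
    using expectation_increment[of 0 x "\<lambda>k. of_bool (k = p)"] \<open>0 < x\<close> by simp
  also have "\<dots> = (\<integral>k. complex_of_real (indicator {p} k) \<partial>measure_pmf (poisson_pmf (r * x)))"
    by (intro Bochner_Integration.integral_cong) (auto split: split_indicator)
  also have "\<dots> = complex_of_real (pmf (poisson_pmf (r * x)) p)"
    by (simp add: measure_pmf_single)
  finally show ?thesis
    using \<open>0 < x\<close> rate_pos by simp
qed

text \<open>On the event that the count at x is p, the power splits into u^p times u to the
  increment over (x, y], which is independent of the past. Degenerate intervals are treated as
  separate cases.\<close>

lemma expectation_count_joint: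
  fixes u :: complex
  assumes "0 \<le> x" "x \<le> y" "norm u \<le> 1"
  shows "expectation (\<lambda>\<omega>. of_bool (count x \<omega> = p) * u ^ count y \<omega>) =
    count_transform r u p x y"
proof -
  consider "y = x" | "x = 0" "x < y" | "0 < x" "x < y"
    using assms by linarith
  then show ?thesis
  proof cases
    case 1
    have "expectation (\<lambda>\<omega>. of_bool (count x \<omega> = p) * u ^ count y \<omega>) =
        expectation (\<lambda>\<omega>. of_bool (count x \<omega> = p) * u ^ p)"
      by (intro Bochner_Integration.integral_cong) (auto simp: 1)
    also have "\<dots> = expectation (\<lambda>\<omega>. of_bool (count x \<omega> = p)) * u ^ p"
      by simp
    finally show ?thesis
      unfolding expectation_count_eq[OF assms(1)] by (simp add: 1 count_transform_def)
  next
    case 2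
    have "expectation (\<lambda>\<omega>. of_bool (count x \<omega> = p) * u ^ count y \<omega>) =
        expectation (\<lambda>\<omega>. of_bool (p = 0) * u ^ point_mass s w {0<..y} \<omega>)"
      using AE_count_0 AE_count_eq[of y] 2 assms by (intro integral_cong_AE) auto
    also have "\<dots> = of_bool (p = 0) * (\<integral>k. u ^ k \<partial>measure_pmf (poisson_pmf (r * y)))"
      using expectation_increment[of 0 y "\<lambda>k. u ^ k"] 2 by simp
    finally show ?thesis
      using 2 rate_pos by (cases p) (simp_all add: integral_poisson_power count_transform_def algebra_simps)
  next
    case 3
    have "expectation (\<lambda>\<omega>. of_bool (count x \<omega> = p) * u ^ count y \<omega>) =
        expectation (\<lambda>\<omega>. u ^ p * (of_bool (point_mass s w {0<..x} \<omega> = p) * u ^ point_mass s w {x<..y} \<omega>))"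
    proof (intro integral_cong_AE)
      have "AE \<omega> in P. count x \<omega> = point_mass s w {0<..x} \<omega> \<and>
          count y \<omega> = point_mass s w {0<..x} \<omega> + point_mass s w {x<..y} \<omega>"
        using AE_count_eq[OF assms(1)] AE_increment[OF assms(2)] AE_count_mono[OF assms(2)]
        by eventually_elim simp
      then show "AE \<omega> in P. of_bool (count x \<omega> = p) * u ^ count y \<omega> =
          u ^ p * (of_bool (point_mass s w {0<..x} \<omega> = p) * u ^ point_mass s w {x<..y} \<omega>)"
        by eventually_elim (simp add: power_add)
    qed simp_all
    also have "\<dots> = u ^ p * (expectation (\<lambda>\<omega>. of_bool (point_mass s w {0<..x} \<omega> = p)) *
        expectation (\<lambda>\<omega>. u ^ point_mass s w {x<..y} \<omega>))"
      using expectation_increments_mult[OF 3, of "\<lambda>k. of_bool (k = p)" "\<lambda>k. u ^ k"] assms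
      by (simp add: norm_power power_le_one)
    also have "expectation (\<lambda>\<omega>. of_bool (point_mass s w {0<..x} \<omega> = p)) =
        complex_of_real ((r * x) ^ p / fact p * exp (- r * x))"
      using AE_count_eq[of x] 3 unfolding expectation_count_eq[OF assms(1), symmetric]
      by (intro integral_cong_AE) auto
    also have "expectation (\<lambda>\<omega>. u ^ point_mass s w {x<..y} \<omega>) = exp (r * (u - 1) * complex_of_real (y - x))"
      using expectation_increment[of x y "\<lambda>k. u ^ k"] 3 rate_pos
      by (simp add: integral_poisson_power algebra_simps)
    finally show ?thesis
      by (simp add: count_transform_def)
  qed
qed

end

section \<open>Observation at independent epochs\<close>

text \<open>Independence makes the joint law a product measure, checked on rectangles. Fubini then
  allows Y to be frozen at its value while X is averaged.\<close>

lemma indep_elements_integral: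
  fixes F :: "'x \<times> 'y \<Rightarrow> 'b::{banach, second_countable_topology}"
  assumes "prob_space P" and indep: "indep_elements P K X L Y"
    and F [measurable]: "F \<in> borel_measurable (K \<Otimes>\<^sub>M L)"
    and int: "integrable P (\<lambda>\<omega>. F (X \<omega>, Y \<omega>))"
  shows "(\<integral>\<omega>. F (X \<omega>, Y \<omega>) \<partial>P) = (\<integral>\<omega>. (\<integral>\<omega>'. F (X \<omega>', Y \<omega>) \<partial>P) \<partial>P)"
proof -
  interpret prob_space P by fact
  have X [measurable]: "X \<in> measurable P K" and Y [measurable]: "Y \<in> measurable P L"
    and set: "indep_set (sets (vimage_algebra (space P) X K)) (sets (vimage_algebra (space P) Y L))"
    using indep by (auto simp: indep_elements_def)
  interpret X: prob_space "distr P K X" by (rule prob_space_distr) fact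
  interpret Y: prob_space "distr P L Y" by (rule prob_space_distr) fact
  interpret XY: pair_sigma_finite "distr P K X" "distr P L Y" ..
  have distr: "distr P K X \<Otimes>\<^sub>M distr P L Y = distr P (K \<Otimes>\<^sub>M L) (\<lambda>\<omega>. (X \<omega>, Y \<omega>))"
  proof (rule pair_measure_eqI)
    fix A B assume "A \<in> sets (distr P K X)" "B \<in> sets (distr P L Y)"
    then have [measurable]: "A \<in> sets K" "B \<in> sets L" by auto
    define A' where "A' = X -` A \<inter> space P"
    define B' where "B' = Y -` B \<inter> space P"
    have "A' \<in> sets (vimage_algebra (space P) X K)" "B' \<in> sets (vimage_algebra (space P) Y L)"
      unfolding A'_def B'_def by (auto intro!: in_vimage_algebra)
    with set have "prob (A' \<inter> B') = prob A' * prob B'"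
      by (rule indep_setD)
    then have "emeasure P (A' \<inter> B') = emeasure P A' * emeasure P B'"
      by (simp add: emeasure_eq_measure ennreal_mult)
    moreover have "(\<lambda>\<omega>. (X \<omega>, Y \<omega>)) -` (A \<times> B) \<inter> space P = A' \<inter> B'"
      by (auto simp: A'_def B'_def)
    ultimately show "emeasure (distr P K X) A * emeasure (distr P L Y) B =
        emeasure (distr P (K \<Otimes>\<^sub>M L) (\<lambda>\<omega>. (X \<omega>, Y \<omega>))) (A \<times> B)"
      by (simp add: emeasure_distr A'_def B'_def)
  qed (auto intro: X.sigma_finite_measure_axioms Y.sigma_finite_measure_axioms simp: sets_distr cong: sets_pair_measure_cong)
  have int': "integrable (distr P K X \<Otimes>\<^sub>M distr P L Y) (case_prod (\<lambda>x y. F (x, y)))"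
    unfolding distr using int by (subst integrable_distr_eq) auto
  have "(\<integral>\<omega>. F (X \<omega>, Y \<omega>) \<partial>P) = integral\<^sup>L (distr P K X \<Otimes>\<^sub>M distr P L Y) F"
    unfolding distr by (subst integral_distr) auto
  also have "\<dots> = (\<integral>y. (\<integral>x. F (x, y) \<partial>distr P K X) \<partial>distr P L Y)"
    using XY.integral_snd[OF int'] by simp
  also have "\<dots> = (\<integral>\<omega>. (\<integral>x. F (x, Y \<omega>) \<partial>distr P K X) \<partial>P)"
    by (rule integral_distr) (auto intro!: X.borel_measurable_lebesgue_integral)
  also have "\<dots> = (\<integral>\<omega>. (\<integral>\<omega>'. F (X \<omega>', Y \<omega>) \<partial>P) \<partial>P)"
  proof (rule Bochner_Integration.integral_cong[OF refl])
    fix \<omega> assume "\<omega> \<in> space P"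
    then have [measurable]: "Y \<omega> \<in> space L"
      by (rule measurable_space[OF Y])
    show "(\<integral>x. F (x, Y \<omega>) \<partial>distr P K X) = (\<integral>\<omega>'. F (X \<omega>', Y \<omega>) \<partial>P)"
      by (rule integral_distr) measurable
  qed
  finally show ?thesis .
qed

lemma borel_measurable_power_nat [measurable]:
  fixes u :: complex
  assumes "f \<in> measurable M (count_space UNIV)"
  shows "(\<lambda>x. u ^ f x) \<in> borel_measurable M"
  by (rule measurable_compose[OF assms]) simp

lemma norm_of_bool_mult_power_le:
  fixes u :: complex
  assumes "norm u \<le> 1"
  shows "norm (of_bool b * u ^ k) \<le> 1"
  using assms by (simp add: norm_mult norm_power power_le_one)

text \<open>\<open>epoch\<close> as a function on the sequence space, so that epochs become
  functions of the random element \<open>times_seq\<close>.\<close>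

definition epoch_of :: "nat \<Rightarrow> (nat \<Rightarrow> real) \<Rightarrow> real" where
  "epoch_of k d = (\<Sum>i=1..k. d i)"

lemma epoch_of_times_seq: "epoch_of k (times_seq D \<omega>) = epoch D k \<omega>"
  by (simp add: epoch_of_def times_seq_def epoch_def)

lemma borel_measurable_epoch_of [measurable]: "epoch_of k \<in> borel_measurable times_space"
  unfolding epoch_of_def times_space_def by (intro borel_measurable_sum measurable_component_singleton) auto

lemma epoch_0 [simp]: "epoch D 0 \<omega> = 0"
  by (simp add: epoch_def)

lemma epoch_Suc: "epoch D (Suc k) \<omega> = epoch D k \<omega> + D (Suc k) \<omega>"
  by (simp add: epoch_def)

section \<open>Both players observed at the renewal epochs\<close>

locale observed_game =
  A: unit_poisson_process P lam s w + B: unit_poisson_process P \<mu> t z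
  for P :: "'w measure" and lam s w \<mu> t z +
  fixes \<gamma> :: real and \<Delta> :: "nat \<Rightarrow> 'w \<Rightarrow> real"
  assumes \<gamma>_pos: "0 < \<gamma>" and renewal: "renewal_exponential P \<gamma> \<Delta>"
    and indep_players: "indep_elements P point_space (points s w) point_space (points t z)"
    and indep_observation: "indep_elements P
           (point_space \<Otimes>\<^sub>M point_space) (\<lambda>\<omega>. (points s w \<omega>, points t z \<omega>))
           times_space (times_seq \<Delta>)"
begin

abbreviation "expectation \<equiv> A.expectation"
abbreviation "dmgA \<equiv> cum_damage s w \<Delta>"
abbreviation "dmgB \<equiv> cum_damage t z \<Delta>"
abbreviation "\<tau> \<equiv> epoch \<Delta>"

lemma measurable_inter_time [measurable]: "1 \<le> i \<Longrightarrow> \<Delta> i \<in> borel_measurable P"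
  using renewal by (auto simp: renewal_exponential_def dest!: distributed_measurable)

lemma measurable_epoch [measurable]: "\<tau> k \<in> borel_measurable P"
  unfolding epoch_def[abs_def] by (intro borel_measurable_sum) auto

lemma measurable_times_seq [measurable]: "times_seq \<Delta> \<in> measurable P times_space"
  using indep_observation by (simp add: indep_elements_def)

lemma distributed_inter_time: "1 \<le> i \<Longrightarrow> distributed P lborel (\<Delta> i) (exponential_density \<gamma>)"
  using renewal by (auto simp: renewal_exponential_def)

lemma AE_inter_time_nonneg: "AE \<omega> in P. \<forall>i\<ge>1. 0 \<le> \<Delta> i \<omega>"
proof -
  have "AE \<omega> in P. 0 \<le> \<Delta> i \<omega>" if "1 \<le> i" for i
    by (subst A.distributed_AE2[OF distributed_inter_time[OF that]]) (auto simp: exponential_density_def)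
  then show ?thesis
    by (auto simp: AE_all_countable)
qed

lemma AE_epoch_nonneg: "AE \<omega> in P. 0 \<le> \<tau> k \<omega>"
  using AE_inter_time_nonneg by eventually_elim (auto simp: epoch_def intro!: sum_nonneg)

lemma AE_epoch_mono: "AE \<omega> in P. \<tau> k \<omega> \<le> \<tau> (Suc k) \<omega>"
  using AE_inter_time_nonneg by eventually_elim (auto simp: epoch_Suc)

text \<open>The mass at time 0 vanishes almost surely, and nonnegative gaps make the epochs
  nondecreasing, so the differences of counts telescope even with truncated subtraction.\<close>

lemma AE_cum_damage:
  "AE \<omega> in P. dmgA k \<omega> = A.count (\<tau> k \<omega>) \<omega> \<and> dmgB k \<omega> = B.count (\<tau> k \<omega>) \<omega>"
  using A.AE_point_mass B.AE_point_mass AE_inter_time_nonneg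
proof eventually_elim
  case (elim \<omega>)
  have "\<tau> k \<omega> \<le> \<tau> (Suc k) \<omega>" for k
    using elim(3) by (simp add: epoch_Suc)
  then show ?case
    using elim(1,2) by (induction k) (simp_all add: cum_damage_def casualties_def)
qed

text \<open>Freezing the points of B and averaging over A factorises the expectation, leaving one
  transform per player.\<close>

lemma expectation_counts:
  fixes u v :: complex
  assumes u: "norm u \<le> 1" and v: "norm v \<le> 1"
    and x: "0 \<le> x" "x \<le> y"
  shows "expectation (\<lambda>\<omega>. (of_bool (A.count x \<omega> = p) * u ^ A.count y \<omega>) *
      (of_bool (B.count x \<omega> = q) * v ^ B.count y \<omega>)) =
    count_transform lam u p x y * count_transform \<mu> v q x y"
proof -
  define f where "f \<xi> = of_bool (count_upto \<xi> x = p) * u ^ count_upto \<xi> y" for \<xi>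
  define g where "g \<xi> = of_bool (count_upto \<xi> x = q) * v ^ count_upto \<xi> y" for \<xi>
  have [measurable]: "f \<in> borel_measurable point_space" "g \<in> borel_measurable point_space"
    unfolding f_def g_def by measurable
  have le: "norm (f \<xi>) \<le> 1" "norm (g \<xi>) \<le> 1" for \<xi>
    unfolding f_def g_def using u v by (simp_all add: norm_of_bool_mult_power_le)
  define F where "F x = f (fst x) * g (snd x)" for x
  have F: "F \<in> borel_measurable (point_space \<Otimes>\<^sub>M point_space)"
    unfolding F_def by measurable
  have "integrable P (\<lambda>\<omega>. F (points s w \<omega>, points t z \<omega>))"
  proof (rule A.integrable_const_bound[where B = 1])
    show "(\<lambda>\<omega>. F (points s w \<omega>, points t z \<omega>)) \<in> borel_measurable P"
      by (rule measurable_compose[OF _ F]) measurable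
    show "AE \<omega> in P. norm (F (points s w \<omega>, points t z \<omega>)) \<le> 1"
      unfolding F_def fst_conv snd_conv norm_mult by (intro AE_I2 mult_le_one le norm_ge_zero)
  qed
  then have "expectation (\<lambda>\<omega>. F (points s w \<omega>, points t z \<omega>)) =
      expectation (\<lambda>\<omega>. expectation (\<lambda>\<omega>'. F (points s w \<omega>', points t z \<omega>)))"
    by (rule indep_elements_integral[OF A.prob_space_axioms indep_players F])
  then have "expectation (\<lambda>\<omega>. f (points s w \<omega>) * g (points t z \<omega>)) =
      expectation (\<lambda>\<omega>. expectation (\<lambda>\<omega>'. f (points s w \<omega>') * g (points t z \<omega>)))"
    by (simp only: F_def fst_conv snd_conv)
  also have "\<dots> = expectation (\<lambda>\<omega>. f (points s w \<omega>)) * expectation (\<lambda>\<omega>. g (points t z \<omega>))"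
    by simp
  finally show ?thesis
    unfolding f_def g_def A.expectation_count_joint[OF x u] B.expectation_count_joint[OF x v] .
qed

text \<open>Conditioning on the observation process: once the gaps are frozen, S and T are fixed
  times and \<open>expectation_counts\<close> applies inside the outer expectation.\<close>

lemma expectation_counts_random_times:
  fixes u v :: complex and \<phi> :: "(nat \<Rightarrow> real) \<Rightarrow> complex"
  assumes u: "norm u \<le> 1" and v: "norm v \<le> 1"
    and [measurable]: "\<phi> \<in> borel_measurable times_space"
    and [measurable]: "S \<in> borel_measurable times_space" "T \<in> borel_measurable times_space"
    and \<phi>: "AE \<omega> in P. norm (\<phi> (times_seq \<Delta> \<omega>)) \<le> 1"
    and ST: "AE \<omega> in P. 0 \<le> S (times_seq \<Delta> \<omega>) \<and> S (times_seq \<Delta> \<omega>) \<le> T (times_seq \<Delta> \<omega>)"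
  shows "expectation (\<lambda>\<omega>. let x = S (times_seq \<Delta> \<omega>); y = T (times_seq \<Delta> \<omega>) in
      \<phi> (times_seq \<Delta> \<omega>) * ((of_bool (A.count x \<omega> = p) * u ^ A.count y \<omega>) *
        (of_bool (B.count x \<omega> = q) * v ^ B.count y \<omega>))) =
    expectation (\<lambda>\<omega>. let x = S (times_seq \<Delta> \<omega>); y = T (times_seq \<Delta> \<omega>) in
      \<phi> (times_seq \<Delta> \<omega>) *
      (count_transform lam u p x y * count_transform \<mu> v q x y))"
    (is "?l = ?r")
proof -
  define H where "H x = \<phi> (snd x) *
      ((of_bool (count_upto (fst (fst x)) (S (snd x)) = p) * u ^ count_upto (fst (fst x)) (T (snd x))) *
       (of_bool (count_upto (snd (fst x)) (S (snd x)) = q) * v ^ count_upto (snd (fst x)) (T (snd x))))" for x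
  have H: "H \<in> borel_measurable ((point_space \<Otimes>\<^sub>M point_space) \<Otimes>\<^sub>M times_space)"
    unfolding H_def by measurable
  let ?X = "\<lambda>\<omega>. (points s w \<omega>, points t z \<omega>)" and ?D = "times_seq \<Delta>"
  have H_meas: "(\<lambda>\<omega>. H (?X \<omega>, ?D \<omega>)) \<in> borel_measurable P"
    by (rule measurable_compose[OF _ H]) measurable
  have "AE \<omega> in P. norm (H (?X \<omega>, ?D \<omega>)) \<le> 1"
    using \<phi> unfolding H_def fst_conv snd_conv norm_mult[of "\<phi> _"] norm_mult[of "of_bool _ * _" "of_bool _ * _"]
    by eventually_elim (intro mult_le_one norm_of_bool_mult_power_le u v mult_nonneg_nonneg norm_ge_zero)
  then have "integrable P (\<lambda>\<omega>. H (?X \<omega>, ?D \<omega>))"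
    by (intro A.integrable_const_bound[where B = 1] H_meas)
  with H have "expectation (\<lambda>\<omega>. H (?X \<omega>, ?D \<omega>)) =
      expectation (\<lambda>\<omega>. expectation (\<lambda>\<omega>'. H (?X \<omega>', ?D \<omega>)))"
    by (intro indep_elements_integral[OF A.prob_space_axioms indep_observation])
  also have "\<dots> = ?r"
  proof (rule integral_cong_AE)
    show "(\<lambda>\<omega>. expectation (\<lambda>\<omega>'. H (?X \<omega>', ?D \<omega>))) \<in> borel_measurable P"
      by (rule A.borel_measurable_lebesgue_integral, unfold split_beta', rule measurable_compose[OF _ H]) measurable
    show "AE \<omega> in P. expectation (\<lambda>\<omega>'. H (?X \<omega>', ?D \<omega>)) =
        (let x = S (times_seq \<Delta> \<omega>); y = T (times_seq \<Delta> \<omega>) in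
      \<phi> (times_seq \<Delta> \<omega>) *
      (count_transform lam u p x y * count_transform \<mu> v q x y))"
      using ST
    proof eventually_elim
      case (elim \<omega>)
      then show ?case
        unfolding H_def fst_conv snd_conv Let_def integral_mult_right_zero
        by (simp only: expectation_counts[OF u v])
    qed
  qed (unfold Let_def, measurable)
  also have "expectation (\<lambda>\<omega>. H (?X \<omega>, ?D \<omega>)) = ?l"
    by (simp add: H_def Let_def)
  finally show ?thesis .
qed

end

section \<open>Transforms at the observation epochs\<close>

lemma integral_erlang_density:
  fixes g :: "real \<Rightarrow> complex"
  assumes "distributed P lborel X (erlang_density k l)" "0 \<le> l" and [measurable]: "g \<in> borel_measurable borel"
  shows "(\<integral>\<omega>. g (X \<omega>) \<partial>P) = (LBINT x:{0<..}. erlang_density k l x *\<^sub>R g x)"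
proof -
  have [measurable]: "X \<in> borel_measurable P"
    using distributed_measurable[OF assms(1)] by simp
  have "(\<integral>\<omega>. g (X \<omega>) \<partial>P) = integral\<^sup>L (distr P lborel X) g"
    by (subst integral_distr) auto
  also have "\<dots> = (\<integral>x. erlang_density k l x *\<^sub>R g x \<partial>lborel)"
    unfolding distributed_distr_eq_density[OF assms(1)] using \<open>0 \<le> l\<close> by (subst integral_density) auto
  also have "\<dots> = (LBINT x:{0<..}. erlang_density k l x *\<^sub>R g x)"
    unfolding set_lebesgue_integral_def
  proof (rule integral_cong_AE)
    \<comment> \<open>The density vanishes on negative arguments, so restricting to the open
      half-line discards only the null set {0}.\<close>
    show "AE x in lborel. erlang_density k l x *\<^sub>R g x = indicator {0<..} x *\<^sub>R (erlang_density k l x *\<^sub>R g x)"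
      using AE_lborel_singleton[of 0] by eventually_elim (auto simp: erlang_density_def split: split_indicator)
  qed auto
  finally show ?thesis .
qed

text \<open>Sum and integral are exchanged by dominated convergence: partial sums of Erlang
  densities increase to the constant l, so l |g| dominates.\<close>

lemma sums_integral_erlang_density:
  fixes g :: "real \<Rightarrow> complex"
  assumes "0 < l" and g: "set_integrable lborel {0<..} g" and [measurable]: "g \<in> borel_measurable borel"
  shows "(\<lambda>k. LBINT x:{0<..}. erlang_density k l x *\<^sub>R g x) sums (l * (LBINT x:{0<..}. g x))"
proof -
  define G where "G x = indicator {0<..} x *\<^sub>R g x" for x
  have G: "integrable lborel G"
    using g unfolding set_integrable_def G_def .
  have [measurable]: "G \<in> borel_measurable borel"
    unfolding G_def by measurable
  define s where "s n x = (\<Sum>k<n. erlang_density k l x) *\<^sub>R G x" for n x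
  have lim: "(\<lambda>n. s n x) \<longlonglongrightarrow> l *\<^sub>R G x" for x
  proof (cases "0 < x")
    case True
    then show ?thesis
      using sums_erlang_density[of x l] unfolding s_def sums_def by (intro tendsto_scaleR) auto
  qed (simp add: s_def G_def)
  have bound: "norm (s n x) \<le> l * norm (G x)" for n x
  proof (cases "0 < x")
    case True
    have "(\<Sum>k<n. erlang_density k l x) \<le> l"
      using sums_erlang_density[of x l] True \<open>0 < l\<close>
      by (metis (mono_tags, lifting) erlang_density_nonneg less_imp_le sum_le_suminf finite_lessThan sums_iff)
    moreover have "0 \<le> (\<Sum>k<n. erlang_density k l x)"
      using \<open>0 < l\<close> by (intro sum_nonneg) auto
    ultimately show ?thesis
      by (simp add: s_def mult_right_mono)
  qed (simp add: s_def G_def)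
  have int: "integrable lborel (\<lambda>x. erlang_density k l x *\<^sub>R G x)" for k
  proof (rule Bochner_Integration.integrable_bound)
    show "integrable lborel (\<lambda>x. l *\<^sub>R G x)"
      using G by simp
    show "AE x in lborel. norm (erlang_density k l x *\<^sub>R G x) \<le> norm (l *\<^sub>R G x)"
    proof (rule AE_I2)
      fix x
      have "erlang_density k l x \<le> (\<Sum>j<Suc k. erlang_density j l x)"
        using \<open>0 < l\<close> by (simp add: sum_nonneg)
      then have "norm (erlang_density k l x *\<^sub>R G x) \<le> norm (s (Suc k) x)"
        using \<open>0 < l\<close> by (auto simp: s_def intro!: mult_right_mono)
      then show "norm (erlang_density k l x *\<^sub>R G x) \<le> norm (l *\<^sub>R G x)"
        using bound[of "Suc k" x] \<open>0 < l\<close> by simp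
    qed
  qed simp
  have "(\<lambda>n. integral\<^sup>L lborel (s n)) \<longlonglongrightarrow> integral\<^sup>L lborel (\<lambda>x. l *\<^sub>R G x)"
  proof (rule integral_dominated_convergence[where w = "\<lambda>x. l * norm (G x)"])
    show "s n \<in> borel_measurable lborel" for n
      unfolding s_def by measurable
  qed (use G bound lim in auto)
  moreover have "integral\<^sup>L lborel (s n) = (\<Sum>k<n. LBINT x:{0<..}. erlang_density k l x *\<^sub>R g x)" for n
  proof -
    have "integral\<^sup>L lborel (s n) = (\<Sum>k<n. \<integral>x. erlang_density k l x *\<^sub>R G x \<partial>lborel)"
      unfolding s_def scaleR_sum_left using int by (subst Bochner_Integration.integral_sum) auto
    then show ?thesis
      by (simp add: set_lebesgue_integral_def G_def mult.commute)
  qed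
  moreover have "integral\<^sup>L lborel (\<lambda>x. l *\<^sub>R G x) = l * (LBINT x:{0<..}. g x)"
    by (simp add: set_lebesgue_integral_def G_def scaleR_conv_of_real)
  ultimately show ?thesis
    unfolding sums_def by simp
qed

text \<open>Separates the state at x from the factor due to the increment over (x, y].\<close>

lemma count_transform_eq:
  "count_transform r u p x y = u ^ p * count_transform r 1 p x x * exp (r * (u - 1) * complex_of_real (y - x))"
  by (simp add: count_transform_def)

text \<open>The bound comes from the expectation that the formula represents, whose integrand has
  norm at most 1.\<close>

lemma (in unit_poisson_process) norm_count_transform_le:
  assumes "0 \<le> x" "x \<le> y" "norm u \<le> 1"
  shows "norm (count_transform r u p x y) \<le> 1"
proof -
  have "norm (count_transform r u p x y) \<le> expectation (\<lambda>\<omega>. norm (of_bool (count x \<omega> = p) * u ^ count y \<omega>))"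
    unfolding expectation_count_joint[OF assms, symmetric] by (rule integral_norm_bound)
  also have "\<dots> \<le> 1"
    using norm_of_bool_mult_power_le[OF assms(3)]
    by (intro integral_le_const integrable_const_bound[where B = 1]) auto
  finally show ?thesis .
qed

section \<open>Damages at one epoch and at the next\<close>

context observed_game
begin

text \<open>This equals E (exp (- \<theta> \<tau>_k); A_k = p, B_k = q) with both attack processes
  already averaged out; only the law of \<tau>_k is left.\<close>

definition epoch_transform :: "complex \<Rightarrow> nat \<Rightarrow> nat \<Rightarrow> nat \<Rightarrow> complex" where
  "epoch_transform \<theta> k p q = expectation (\<lambda>\<omega>. exp (- \<theta> * complex_of_real (\<tau> k \<omega>)) *
     (count_transform lam 1 p (\<tau> k \<omega>) (\<tau> k \<omega>) * count_transform \<mu> 1 q (\<tau> k \<omega>) (\<tau> k \<omega>)))"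

lemma borel_measurable_damage [measurable]:
  "dmgA k \<in> measurable P (count_space UNIV)" "dmgB k \<in> measurable P (count_space UNIV)"
proof -
  have "(\<lambda>\<omega>. casualties s w \<Delta> i \<omega>) \<in> measurable P (count_space UNIV)"
    if "unit_poisson_process P r s w" for r s w i
  proof -
    interpret unit_poisson_process P r s w by fact
    have [measurable]: "Measurable.pred P (\<lambda>\<omega>. s j \<omega> \<in> {\<tau> (i - 1) \<omega><..\<tau> i \<omega>})"
      "Measurable.pred P (\<lambda>\<omega>. s j \<omega> \<in> {0})" if "1 \<le> j" for j
      using measurable_times[OF that] by (simp_all, measurable)
    show ?thesis
      unfolding casualties_def by (cases "i = 0") (simp_all add: measurable_point_mass measurable_masses)
  qed
  from this[OF A.unit_poisson_process_axioms] this[OF B.unit_poisson_process_axioms]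
  show "dmgA k \<in> measurable P (count_space UNIV)" "dmgB k \<in> measurable P (count_space UNIV)"
    unfolding cum_damage_def[abs_def] by (auto intro!: measurable_nat_sum)
qed

lemma norm_exp_epoch_le:
  assumes "0 \<le> Re \<theta>" "0 \<le> x"
  shows "norm (exp (- \<theta> * complex_of_real x)) \<le> 1"
  using assms by simp

text \<open>The state is fixed at epoch k and the discounted damage is taken at epoch l. The two
  choices of l give the values before and after one observation period.\<close>

lemma expectation_damages:
  fixes u v \<theta> :: complex
  assumes u: "norm u \<le> 1" and v: "norm v \<le> 1" and \<theta>: "0 \<le> Re \<theta>" and "l = k \<or> l = Suc k"
  shows "expectation (\<lambda>\<omega>. of_bool (dmgA k \<omega> = p \<and> dmgB k \<omega> = q) *
      (u ^ dmgA l \<omega> * v ^ dmgB l \<omega> * exp (- \<theta> * complex_of_real (\<tau> l \<omega>)))) =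
    expectation (\<lambda>\<omega>. exp (- \<theta> * complex_of_real (\<tau> l \<omega>)) *
      (count_transform lam u p (\<tau> k \<omega>) (\<tau> l \<omega>) * count_transform \<mu> v q (\<tau> k \<omega>) (\<tau> l \<omega>)))"
proof -
  have "expectation (\<lambda>\<omega>. of_bool (dmgA k \<omega> = p \<and> dmgB k \<omega> = q) *
      (u ^ dmgA l \<omega> * v ^ dmgB l \<omega> * exp (- \<theta> * complex_of_real (\<tau> l \<omega>)))) =
    expectation (\<lambda>\<omega>. exp (- \<theta> * complex_of_real (\<tau> l \<omega>)) *
      ((of_bool (A.count (\<tau> k \<omega>) \<omega> = p) * u ^ A.count (\<tau> l \<omega>) \<omega>) *
       (of_bool (B.count (\<tau> k \<omega>) \<omega> = q) * v ^ B.count (\<tau> l \<omega>) \<omega>)))"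
  proof (rule integral_cong_AE)
    show "AE \<omega> in P. of_bool (dmgA k \<omega> = p \<and> dmgB k \<omega> = q) *
      (u ^ dmgA l \<omega> * v ^ dmgB l \<omega> * exp (- \<theta> * complex_of_real (\<tau> l \<omega>))) =
      exp (- \<theta> * complex_of_real (\<tau> l \<omega>)) *
      ((of_bool (A.count (\<tau> k \<omega>) \<omega> = p) * u ^ A.count (\<tau> l \<omega>) \<omega>) *
       (of_bool (B.count (\<tau> k \<omega>) \<omega> = q) * v ^ B.count (\<tau> l \<omega>) \<omega>))"
      using AE_cum_damage[of k] AE_cum_damage[of l] by eventually_elim simp
  qed measurable
  also have "\<dots> = expectation (\<lambda>\<omega>. exp (- \<theta> * complex_of_real (\<tau> l \<omega>)) *
      (count_transform lam u p (\<tau> k \<omega>) (\<tau> l \<omega>) * count_transform \<mu> v q (\<tau> k \<omega>) (\<tau> l \<omega>)))"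
  proof -
    have 1: "(\<lambda>d. exp (- \<theta> * complex_of_real (epoch_of l d))) \<in> borel_measurable times_space"
      by measurable
    have 2: "AE \<omega> in P. norm (exp (- \<theta> * complex_of_real (epoch_of l (times_seq \<Delta> \<omega>)))) \<le> 1"
      using AE_epoch_nonneg[of l] unfolding epoch_of_times_seq
      by eventually_elim (rule norm_exp_epoch_le[OF \<theta>])
    have 3: "AE \<omega> in P. 0 \<le> epoch_of k (times_seq \<Delta> \<omega>) \<and> epoch_of k (times_seq \<Delta> \<omega>) \<le> epoch_of l (times_seq \<Delta> \<omega>)"
      using AE_epoch_nonneg[of k] AE_epoch_mono[of k] unfolding epoch_of_times_seq
      by eventually_elim (use assms(4) in auto)
    show ?thesis
      using expectation_counts_random_times[OF u v 1 borel_measurable_epoch_of borel_measurable_epoch_of 2 3, of p q]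
      unfolding epoch_of_times_seq Let_def .
  qed
  finally show ?thesis .
qed

lemma expectation_damages_now:
  fixes u v \<theta> :: complex
  assumes "norm u \<le> 1" "norm v \<le> 1" "0 \<le> Re \<theta>"
  shows "expectation (\<lambda>\<omega>. of_bool (dmgA k \<omega> = p \<and> dmgB k \<omega> = q) *
      (u ^ dmgA k \<omega> * v ^ dmgB k \<omega> * exp (- \<theta> * complex_of_real (\<tau> k \<omega>)))) =
    u ^ p * v ^ q * epoch_transform \<theta> k p q"
proof -
  have eq: "exp (- \<theta> * complex_of_real (\<tau> k \<omega>)) *
      (count_transform lam u p (\<tau> k \<omega>) (\<tau> k \<omega>) * count_transform \<mu> v q (\<tau> k \<omega>) (\<tau> k \<omega>)) =
    u ^ p * v ^ q * (exp (- \<theta> * complex_of_real (\<tau> k \<omega>)) *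
      (count_transform lam 1 p (\<tau> k \<omega>) (\<tau> k \<omega>) * count_transform \<mu> 1 q (\<tau> k \<omega>) (\<tau> k \<omega>)))" for \<omega>
    using count_transform_eq[of lam u p "\<tau> k \<omega>" "\<tau> k \<omega>"] count_transform_eq[of \<mu> v q "\<tau> k \<omega>" "\<tau> k \<omega>"]
    by simp
  show ?thesis
    unfolding expectation_damages[OF assms disjI1[OF refl]] epoch_transform_def
    by (simp only: eq integral_mult_right_zero)
qed

lemma expectation_exp_inter_time:
  fixes K :: complex
  assumes "1 \<le> i" "0 \<le> Re K"
  shows "expectation (\<lambda>\<omega>. exp (- K * complex_of_real (\<Delta> i \<omega>))) = \<gamma> / (\<gamma> + K)"
proof -
  have "expectation (\<lambda>\<omega>. exp (- K * complex_of_real (\<Delta> i \<omega>))) =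
      (LBINT x:{0<..}. exponential_density \<gamma> x *\<^sub>R exp (- K * complex_of_real x))"
    using \<gamma>_pos by (intro integral_erlang_density[OF distributed_inter_time[OF assms(1)]]) auto
  also have "\<dots> = (LBINT x:{0<..}. \<gamma> * (of_real x ^ 0 * exp (- (\<gamma> + K) * of_real x)))"
    by (intro set_lebesgue_integral_cong)
      (auto simp: exponential_density_def scaleR_conv_of_real exp_of_real[symmetric] mult_exp_exp algebra_simps
        simp del: exp_of_real)
  also have "\<dots> = \<gamma> * (fact 0 / (\<gamma> + K) ^ Suc 0)"
    using laplace_transform_power[of "\<gamma> + K" 0] \<gamma>_pos assms(2) by simp
  finally show ?thesis
    by simp
qed

text \<open>One more observation multiplies the value at epoch k by a factor that does not depend on
  the state (p, q): the next gap is independent of \<tau>_k, and the increments given that gap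
  contribute exponentials in it.\<close>

lemma expectation_damages_next:
  fixes u v \<theta> :: complex
  assumes u: "norm u \<le> 1" and v: "norm v \<le> 1" and \<theta>: "0 \<le> Re \<theta>"
  shows "expectation (\<lambda>\<omega>. of_bool (dmgA k \<omega> = p \<and> dmgB k \<omega> = q) *
      (u ^ dmgA (Suc k) \<omega> * v ^ dmgB (Suc k) \<omega> * exp (- \<theta> * complex_of_real (\<tau> (Suc k) \<omega>)))) =
    \<gamma> / (\<gamma> + lam * (1 - u) + \<mu> * (1 - v) + \<theta>) * (u ^ p * v ^ q * epoch_transform \<theta> k p q)"
proof -
  define K where "K = lam * (1 - u) + \<mu> * (1 - v) + \<theta>"
  have "Re u \<le> 1" "Re v \<le> 1"
    using u v complex_Re_le_cmod[of u] complex_Re_le_cmod[of v] by linarith+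
  \<comment> \<open>This makes exp (- K x) bounded by 1 for x \<ge> 0, hence integrable at the next
    gap.\<close>
  then have K: "0 \<le> Re K"
    using \<theta> A.rate_pos B.rate_pos by (simp add: K_def)
  define F where "F x = exp (- \<theta> * complex_of_real x) * (count_transform lam 1 p x x * count_transform \<mu> 1 q x x)" for x
  define G where "G x = exp (- K * complex_of_real x)" for x
  have [measurable]: "F \<in> borel_measurable borel" "G \<in> borel_measurable borel"
    unfolding F_def G_def by measurable
  have "A.indep_var borel (\<Delta> (Suc k)) borel (\<lambda>\<omega>. \<Sum>i\<in>{1..k}. \<Delta> i \<omega>)"
    using renewal by (intro A.indep_vars_sum) (auto simp: renewal_exponential_def intro: A.indep_vars_subset)
  then have "A.indep_var borel (G \<circ> \<Delta> (Suc k)) borel (F \<circ> (\<lambda>\<omega>. \<Sum>i\<in>{1..k}. \<Delta> i \<omega>))"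
    by (rule A.indep_var_compose) auto
  then have indep: "A.indep_var borel (\<lambda>\<omega>. G (\<Delta> (Suc k) \<omega>)) borel (\<lambda>\<omega>. F (\<tau> k \<omega>))"
    by (simp add: comp_def epoch_def)
  have int_G: "integrable P (\<lambda>\<omega>. G (\<Delta> (Suc k) \<omega>))"
    using AE_inter_time_nonneg K
    by (intro A.integrable_const_bound[where B = 1]) (auto simp: G_def elim!: eventually_mono)
  have int_F: "integrable P (\<lambda>\<omega>. F (\<tau> k \<omega>))"
  proof (rule A.integrable_const_bound[where B = 1])
    show "AE \<omega> in P. norm (F (\<tau> k \<omega>)) \<le> 1"
      using AE_epoch_nonneg[of k] unfolding F_def norm_mult
      by eventually_elim (intro mult_le_one norm_exp_epoch_le \<theta> A.norm_count_transform_le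
          B.norm_count_transform_le norm_ge_zero mult_nonneg_nonneg, auto)
  qed measurable
  have "exp (- \<theta> * complex_of_real (\<tau> (Suc k) \<omega>)) *
      (count_transform lam u p (\<tau> k \<omega>) (\<tau> (Suc k) \<omega>) * count_transform \<mu> v q (\<tau> k \<omega>) (\<tau> (Suc k) \<omega>)) =
    u ^ p * v ^ q * (G (\<Delta> (Suc k) \<omega>) * F (\<tau> k \<omega>))" for \<omega>
  proof -
    define d where "d = complex_of_real (\<Delta> (Suc k) \<omega>)"
    \<comment> \<open>The factors of both players' increments and of the discount over the next gap
      merge into exp (- K d).\<close>
    have "exp (- \<theta> * complex_of_real (\<tau> (Suc k) \<omega>)) * exp (lam * (u - 1) * d) * exp (\<mu> * (v - 1) * d) =
        exp (- \<theta> * complex_of_real (\<tau> k \<omega>)) * exp (- K * d)"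
      unfolding mult_exp_exp by (rule arg_cong[where f = exp]) (simp add: K_def d_def epoch_Suc algebra_simps)
    moreover have "complex_of_real (\<tau> (Suc k) \<omega> - \<tau> k \<omega>) = d"
      by (simp add: epoch_Suc d_def)
    ultimately show ?thesis
      unfolding F_def G_def d_def[symmetric]
        count_transform_eq[of lam u p "\<tau> k \<omega>" "\<tau> (Suc k) \<omega>"] count_transform_eq[of \<mu> v q "\<tau> k \<omega>" "\<tau> (Suc k) \<omega>"]
      by (simp add: mult_ac)
  qed
  then have "expectation (\<lambda>\<omega>. of_bool (dmgA k \<omega> = p \<and> dmgB k \<omega> = q) *
      (u ^ dmgA (Suc k) \<omega> * v ^ dmgB (Suc k) \<omega> * exp (- \<theta> * complex_of_real (\<tau> (Suc k) \<omega>)))) =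
    u ^ p * v ^ q * expectation (\<lambda>\<omega>. G (\<Delta> (Suc k) \<omega>) * F (\<tau> k \<omega>))"
    unfolding expectation_damages[OF assms disjI2[OF refl]] by simp
  also have "expectation (\<lambda>\<omega>. G (\<Delta> (Suc k) \<omega>) * F (\<tau> k \<omega>)) =
      expectation (\<lambda>\<omega>. G (\<Delta> (Suc k) \<omega>)) * expectation (\<lambda>\<omega>. F (\<tau> k \<omega>))"
    by (rule A.indep_var_lebesgue_integral[OF indep int_G int_F])
  also have "expectation (\<lambda>\<omega>. G (\<Delta> (Suc k) \<omega>)) = \<gamma> / (\<gamma> + K)"
    unfolding G_def by (rule expectation_exp_inter_time[OF _ K]) simp
  also have "expectation (\<lambda>\<omega>. F (\<tau> k \<omega>)) = epoch_transform \<theta> k p q"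
    by (simp add: F_def epoch_transform_def)
  finally show ?thesis
    by (simp add: K_def add.assoc mult_ac)
qed

lemma epoch_transform_0: "epoch_transform \<theta> 0 p q = of_bool (p = 0 \<and> q = 0)"
  by (cases p; cases q) (simp_all add: epoch_transform_def count_transform_def A.prob_space)

text \<open>The renewal density of the observation epochs is constant, so summing over the epochs leaves
  a Gamma integral.\<close>

lemma sums_epoch_transform_Suc:
  fixes \<theta> D :: complex
  assumes "0 \<le> Re \<theta>" and D: "D = lam + \<mu> + \<theta>"
  shows "(\<lambda>k. epoch_transform \<theta> (Suc k) p q) sums
    (\<gamma> / D * (of_nat ((p + q) choose p) * (lam / D) ^ p * (\<mu> / D) ^ q))"
proof -
  have D_pos: "0 < Re D"
    using assms A.rate_pos B.rate_pos by simp
  define F where "F x = exp (- \<theta> * complex_of_real x) * (count_transform lam 1 p x x * count_transform \<mu> 1 q x x)" for x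
  have [measurable]: "F \<in> borel_measurable borel"
    unfolding F_def by measurable
  define c :: complex where "c = lam ^ p * \<mu> ^ q / (fact p * fact q)"
  \<comment> \<open>The two Poisson weights multiply to a power p + q with total rate lam + \<mu>,
    which joins \<theta> to form D.\<close>
  have F: "F x = c * (of_real x ^ (p + q) * exp (- D * of_real x))" for x
  proof -
    have "exp (- D * of_real x) = exp (- \<theta> * of_real x) *
        exp (- complex_of_real lam * of_real x) * exp (- complex_of_real \<mu> * of_real x)"
      unfolding mult_exp_exp by (rule arg_cong[where f = exp]) (simp add: D algebra_simps)
    then show ?thesis
      by (simp add: F_def c_def count_transform_def exp_of_real[symmetric] power_add power_mult_distrib field_simps
          del: exp_of_real)
  qed
  \<comment> \<open>Epoch k + 1 is a sum of k + 1 exponential gaps, hence Erlang with index k. Epoch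
    0 has no density and is treated separately.\<close>
  have "epoch_transform \<theta> (Suc k) p q = (LBINT x:{0<..}. erlang_density k \<gamma> x *\<^sub>R F x)" for k
  proof -
    have "distributed P lborel (\<lambda>\<omega>. \<Sum>i\<in>{1..Suc k}. \<Delta> i \<omega>) (erlang_density (card {1..Suc k} - 1) \<gamma>)"
      using \<gamma>_pos renewal by (intro A.exponential_distributed_sum)
        (auto simp: renewal_exponential_def intro: A.indep_vars_subset)
    then have "distributed P lborel (\<tau> (Suc k)) (erlang_density k \<gamma>)"
      by (simp add: epoch_def[abs_def])
    from integral_erlang_density[OF this, of F] \<gamma>_pos show ?thesis
      by (simp add: epoch_transform_def F_def)
  qed
  moreover have "(\<lambda>k. LBINT x:{0<..}. erlang_density k \<gamma> x *\<^sub>R F x) sums (\<gamma> * (LBINT x:{0<..}. F x))"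
  proof (rule sums_integral_erlang_density[OF \<gamma>_pos])
    show "set_integrable lborel {0<..} F"
      unfolding F by (intro set_integrable_mult_right set_integrable_power_exp D_pos)
  qed measurable
  moreover have "(LBINT x:{0<..}. F x) = c * (fact (p + q) / D ^ Suc (p + q))"
    unfolding F using laplace_transform_power[OF D_pos, of "p + q"] by simp
  moreover have "\<gamma> * (c * (fact (p + q) / D ^ Suc (p + q))) =
      \<gamma> / D * (of_nat ((p + q) choose p) * (lam / D) ^ p * (\<mu> / D) ^ q)"
    by (simp add: c_def binomial_fact power_add power_divide mult_ac)
  ultimately show ?thesis
    by simp
qed

end

section \<open>The exit functional\<close>

text \<open>Since E is closed downwards, the retained differences form an initial segment, and the
  telescoping stops at n or at the first failure of E, whichever is earlier.\<close>

lemma stopped_sequence_sum: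
  fixes Z :: "nat \<Rightarrow> 'a::ab_group_add"
  assumes antimono: "\<And>k. E (Suc k) \<Longrightarrow> E k"
  shows "Z 0 + (\<Sum>k<n. if E k then Z (Suc k) - Z k else 0) = Z (if \<forall>k<n. E k then n else LEAST k. \<not> E k)"
proof (induction n)
  case (Suc n)
  have down: "E j" if "E k" "j \<le> k" for j k
    using that(2,1) by (induction rule: inc_induct) (auto intro: antimono)
  show ?case
  proof (cases "E n")
    case True
    then have "\<forall>k<Suc n. E k"
      using down by auto
    with Suc.IH True show ?thesis
      by (simp add: algebra_simps)
  next
    case False
    have "(LEAST k. \<not> E k) = n" if "\<forall>k<n. E k"
      using that False by (intro Least_equality) (auto simp: not_le[symmetric])
    with Suc.IH False show ?thesis
      by (auto simp: less_Suc_eq)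
  qed
qed simp

text \<open>Damages are integers, so a real threshold may be replaced by its ceiling. The minimum of
  the two infima is the infimum over the union, that is, over the epochs at which E fails. The
  default on infinite exit is carried along unchanged.\<close>

lemma the_enat_exit_index:
  fixes A B :: "nat \<Rightarrow> 'w \<Rightarrow> nat" and M N :: real
  defines "E \<equiv> \<lambda>\<omega> k. A k \<omega> < nat \<lceil>M\<rceil> \<and> B k \<omega> < nat \<lceil>N\<rceil>"
  shows "the_enat (exit_index A B M N \<omega>) = (if \<exists>k. \<not> E \<omega> k then LEAST k. \<not> E \<omega> k else the_enat \<infinity>)"
proof -
  have E: "\<not> E \<omega> k \<longleftrightarrow> M \<le> real (A k \<omega>) \<or> N \<le> real (B k \<omega>)" for k
    unfolding E_def by (simp add: not_less nat_le_iff ceiling_le_iff)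
  have "exit_index A B M N \<omega> = (INF k\<in>{k. \<not> E \<omega> k}. enat k)"
    unfolding exit_index_def passage_index_def E Collect_disj_eq INF_union inf_min ..
  moreover have "(INF k\<in>{k. \<not> E \<omega> k}. enat k) = enat (LEAST k. \<not> E \<omega> k)" if "\<exists>k. \<not> E \<omega> k"
  proof (rule antisym)
    show "(INF k\<in>{k. \<not> E \<omega> k}. enat k) \<le> enat (LEAST k. \<not> E \<omega> k)"
      using LeastI_ex[OF that] by (intro INF_lower) simp
    show "enat (LEAST k. \<not> E \<omega> k) \<le> (INF k\<in>{k. \<not> E \<omega> k}. enat k)"
      by (intro INF_greatest) (auto intro: Least_le)
  qed
  moreover have "(INF k\<in>{k. \<not> E \<omega> k}. enat k) = \<infinity>" if "\<nexists>k. \<not> E \<omega> k"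
    using that by (simp add: top_enat_def)
  ultimately show ?thesis
    by auto
qed

lemma cum_damage_Suc: "cum_damage s w D k \<omega> \<le> cum_damage s w D (Suc k) \<omega>"
  by (simp add: cum_damage_def)

lemma of_bool_less_eq_sum:
  fixes a b m n :: nat and c :: "'a::comm_semiring_1"
  shows "of_bool (a < m \<and> b < n) * c = (\<Sum>p<m. \<Sum>q<n. of_bool (a = p \<and> b = q) * c)"
proof -
  have "(\<Sum>q<n. of_bool (a = p \<and> b = q) * c) = (if p = a then of_bool (b < n) * c else 0)" for p
  proof -
    have "(\<Sum>q<n. of_bool (a = p \<and> b = q) * c) = (\<Sum>q<n. if q = b then of_bool (a = p) * c else 0)"
      by (intro sum.cong refl) auto
    also have "\<dots> = (if b \<in> {..<n} then of_bool (a = p) * c else 0)"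
      by (rule sum.delta) simp
    finally show ?thesis
      by auto
  qed
  then show ?thesis
    by simp
qed

section \<open>Stopping the discounted damage at the exit index\<close>

context observed_game
begin

text \<open>As damages never decrease, this condition at epoch k alone says that the exit index
  exceeds k.\<close>

definition alive :: "nat \<Rightarrow> nat \<Rightarrow> 'w \<Rightarrow> nat \<Rightarrow> bool" where
  "alive m n \<omega> k \<longleftrightarrow> dmgA k \<omega> < m \<and> dmgB k \<omega> < n"

definition discounted :: "complex \<Rightarrow> complex \<Rightarrow> complex \<Rightarrow> nat \<Rightarrow> 'w \<Rightarrow> complex" where
  "discounted u v \<theta> k \<omega> = u ^ dmgA k \<omega> * v ^ dmgB k \<omega> * exp (- \<theta> * complex_of_real (\<tau> k \<omega>))"

definition alive_transform :: "nat \<Rightarrow> nat \<Rightarrow> complex \<Rightarrow> complex \<Rightarrow> complex \<Rightarrow> nat \<Rightarrow> complex" where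
  "alive_transform m n u v \<theta> k = (\<Sum>p<m. \<Sum>q<n. u ^ p * v ^ q * epoch_transform \<theta> k p q)"

lemma borel_measurable_discounted [measurable]: "discounted u v \<theta> k \<in> borel_measurable P"
  unfolding discounted_def by measurable

lemma pred_alive [measurable]: "Measurable.pred P (\<lambda>\<omega>. alive m n \<omega> k)"
  unfolding alive_def by measurable

lemma alive_antimono: "alive m n \<omega> (Suc k) \<Longrightarrow> alive m n \<omega> k"
  using cum_damage_Suc[of s w \<Delta> k \<omega>] cum_damage_Suc[of t z \<Delta> k \<omega>] by (auto simp: alive_def)

context
  fixes u v \<theta> :: complex
  assumes u: "norm u \<le> 1" and v: "norm v \<le> 1" and \<theta>: "0 \<le> Re \<theta>"
begin

lemma AE_norm_discounted_le: "AE \<omega> in P. norm (discounted u v \<theta> k \<omega>) \<le> 1"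
  using AE_epoch_nonneg[of k] unfolding discounted_def norm_mult
  by eventually_elim (intro mult_le_one norm_exp_epoch_le norm_ge_zero mult_nonneg_nonneg,
      use u v \<theta> in \<open>auto simp: norm_power power_le_one\<close>)

lemma integrable_of_bool_discounted:
  assumes [measurable]: "Measurable.pred P Q"
  shows "integrable P (\<lambda>\<omega>. of_bool (Q \<omega>) * discounted u v \<theta> k \<omega>)"
proof (rule A.integrable_const_bound[where B = 1])
  show "AE \<omega> in P. norm (of_bool (Q \<omega>) * discounted u v \<theta> k \<omega>) \<le> 1"
    using AE_norm_discounted_le[of k] by eventually_elim (simp add: norm_mult)
qed measurable

lemma expectation_alive_sum:
  "expectation (\<lambda>\<omega>. of_bool (alive m n \<omega> k) * discounted u v \<theta> l \<omega>) =
    (\<Sum>p<m. \<Sum>q<n. expectation (\<lambda>\<omega>. of_bool (dmgA k \<omega> = p \<and> dmgB k \<omega> = q) * discounted u v \<theta> l \<omega>))"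
proof -
  define f where "f p q \<omega> = of_bool (dmgA k \<omega> = p \<and> dmgB k \<omega> = q) * discounted u v \<theta> l \<omega>" for p q \<omega>
  have "integrable P (f p q)" for p q
    unfolding f_def by (rule integrable_of_bool_discounted) measurable
  then show ?thesis
    unfolding alive_def of_bool_less_eq_sum f_def[symmetric]
    by (simp add: Bochner_Integration.integral_sum Bochner_Integration.integrable_sum)
qed

lemma expectation_alive_now:
  "expectation (\<lambda>\<omega>. of_bool (alive m n \<omega> k) * discounted u v \<theta> k \<omega>) = alive_transform m n u v \<theta> k"
  unfolding expectation_alive_sum alive_transform_def
  unfolding discounted_def expectation_damages_now[OF u v \<theta>] ..

lemma expectation_alive_next:
  "expectation (\<lambda>\<omega>. of_bool (alive m n \<omega> k) * discounted u v \<theta> (Suc k) \<omega>) =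
    \<gamma> / (\<gamma> + lam * (1 - u) + \<mu> * (1 - v) + \<theta>) * alive_transform m n u v \<theta> k"
  unfolding expectation_alive_sum alive_transform_def sum_distrib_left
  unfolding discounted_def expectation_damages_next[OF u v \<theta>] ..

lemma sums_alive_transform:
  fixes D :: complex
  assumes "0 < m" "0 < n" and D: "D = lam + \<mu> + \<theta>"
  shows "alive_transform m n u v \<theta> sums (1 + \<gamma> / D *
    (\<Sum>p<m. \<Sum>q<n. of_nat ((p + q) choose p) * (lam * u / D) ^ p * (\<mu> * v / D) ^ q))"
proof -
  have "(\<lambda>k. alive_transform m n u v \<theta> (Suc k)) sums (\<Sum>p<m. \<Sum>q<n. u ^ p * v ^ q *
      (\<gamma> / D * (of_nat ((p + q) choose p) * (lam / D) ^ p * (\<mu> / D) ^ q)))"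
    unfolding alive_transform_def by (intro sums_sum sums_mult sums_epoch_transform_Suc \<theta> D)
  also have "(\<Sum>p<m. \<Sum>q<n. u ^ p * v ^ q * (\<gamma> / D * (of_nat ((p + q) choose p) * (lam / D) ^ p * (\<mu> / D) ^ q))) =
      \<gamma> / D * (\<Sum>p<m. \<Sum>q<n. of_nat ((p + q) choose p) * (lam * u / D) ^ p * (\<mu> * v / D) ^ q)"
    unfolding sum_distrib_left by (intro sum.cong refl) (simp add: power_mult_distrib power_divide)
  finally have "alive_transform m n u v \<theta> sums (\<gamma> / D *
      (\<Sum>p<m. \<Sum>q<n. of_nat ((p + q) choose p) * (lam * u / D) ^ p * (\<mu> * v / D) ^ q) + alive_transform m n u v \<theta> 0)"
    by (simp add: sums_Suc_iff)
  \<comment> \<open>At epoch 0 only the state (0, 0) has weight, and it lies below the thresholds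
    because m and n are positive.\<close>
  moreover have "alive_transform m n u v \<theta> 0 = (\<Sum>p<m. \<Sum>q<n. of_bool (0 = p \<and> 0 = q) * 1)"
    unfolding alive_transform_def epoch_transform_0 by (intro sum.cong refl) (auto simp: of_bool_def)
  then have "alive_transform m n u v \<theta> 0 = 1"
    using assms(1,2) by (simp only: of_bool_less_eq_sum[symmetric]) simp
  ultimately show ?thesis
    by (simp add: add.commute)
qed

end

text \<open>At u = v = 1 and \<theta> = 0 the summable series of \<open>sums_alive_transform\<close>
  consists of the survival probabilities. Its terms tend to 0, so surviving forever has probability
  0.\<close>

lemma AE_exit:
  assumes "0 < m" "0 < n"
  shows "AE \<omega> in P. \<exists>k. \<not> alive m n \<omega> k"
proof -
  have "alive_transform m n 1 1 0 = (\<lambda>k. complex_of_real (A.prob {\<omega> \<in> space P. alive m n \<omega> k}))"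
  proof
    fix k
    have "alive_transform m n 1 1 0 k = expectation (\<lambda>\<omega>. of_bool (alive m n \<omega> k) * discounted 1 1 0 k \<omega>)"
      by (rule expectation_alive_now[symmetric]) auto
    also have "\<dots> = expectation (\<lambda>\<omega>. complex_of_real (indicator {\<omega> \<in> space P. alive m n \<omega> k} \<omega>))"
      by (intro Bochner_Integration.integral_cong refl) (auto simp: discounted_def)
    also have "\<dots> = complex_of_real (A.prob {\<omega> \<in> space P. alive m n \<omega> k})"
      by (subst integral_complex_of_real) (simp add: Int_def conj_commute)
    finally show "alive_transform m n 1 1 0 k = complex_of_real (A.prob {\<omega> \<in> space P. alive m n \<omega> k})" .
  qed
  moreover have "alive_transform m n 1 1 0 \<longlonglongrightarrow> 0"
    by (rule summable_LIMSEQ_zero, rule sums_summable, rule sums_alive_transform[OF _ _ _ assms refl]) auto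
  ultimately have "(\<lambda>k. complex_of_real (A.prob {\<omega> \<in> space P. alive m n \<omega> k})) \<longlonglongrightarrow> of_real 0"
    by simp
  then have lim: "(\<lambda>k. A.prob {\<omega> \<in> space P. alive m n \<omega> k}) \<longlonglongrightarrow> 0"
    unfolding tendsto_of_real_iff .
  have "A.prob {\<omega> \<in> space P. \<forall>k. alive m n \<omega> k} \<le> 0"
    using lim by (rule LIMSEQ_le_const) (auto intro!: A.finite_measure_mono)
  then have "A.prob {\<omega> \<in> space P. \<forall>k. alive m n \<omega> k} = 0"
    by (simp add: measure_le_0_iff)
  then show ?thesis
    by (subst AE_iff_measurable[OF _ refl]) (auto simp: A.emeasure_eq_measure)
qed

text \<open>Optional stopping by hand: the discounted damage stopped at the exit index or at a fixed
  epoch is a telescoping sum.\<close>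

lemma exit_functional_eq:
  fixes u v \<theta> D :: complex
  assumes u: "norm u \<le> 1" and v: "norm v \<le> 1" and \<theta>: "0 \<le> Re \<theta>"
    and "0 < M" "0 < N" and D: "D = lam + \<mu> + \<theta>"
  defines "g \<equiv> \<gamma> / (\<gamma> + lam * (1 - u) + \<mu> * (1 - v) + \<theta>)"
  defines "T \<equiv> (\<Sum>p<nat \<lceil>M\<rceil>. \<Sum>q<nat \<lceil>N\<rceil>. of_nat ((p + q) choose p) * (lam * u / D) ^ p * (\<mu> * v / D) ^ q)"
  shows "exit_functional P dmgA dmgB \<tau> M N u v \<theta> = 1 - (1 - g) * (1 + \<gamma> / D * T)"
proof -
  define m n where "m = nat \<lceil>M\<rceil>" and "n = nat \<lceil>N\<rceil>"
  have mn: "0 < m" "0 < n"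
    using \<open>0 < M\<close> \<open>0 < N\<close> by (auto simp: m_def n_def)
  define E where "E = alive m n"
  have E_eq: "E = (\<lambda>\<omega> k. dmgA k \<omega> < m \<and> dmgB k \<omega> < n)"
    by (auto simp: E_def alive_def fun_eq_iff)
  define Z where "Z = discounted u v \<theta>"
  define \<rho> where "\<rho> \<omega> = (if \<exists>k. \<not> E \<omega> k then LEAST k. \<not> E \<omega> k else the_enat \<infinity>)" for \<omega>
  have [measurable]: "Z k \<in> borel_measurable P" "Measurable.pred P (\<lambda>\<omega>. E \<omega> k)" for k
    unfolding Z_def E_def by measurable
  have "\<rho> \<in> measurable P (count_space UNIV)"
    unfolding \<rho>_def by measurable
  then have Z_\<rho>: "(\<lambda>\<omega>. Z (\<rho> \<omega>) \<omega>) \<in> borel_measurable P"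
    by (rule measurable_compose_countable[rotated]) measurable
  have exit: "exit_functional P dmgA dmgB \<tau> M N u v \<theta> = expectation (\<lambda>\<omega>. Z (\<rho> \<omega>) \<omega>)"
    unfolding exit_functional_def the_enat_exit_index Let_def Z_def discounted_def \<rho>_def E_eq m_def n_def ..
  \<comment> \<open>The discounted damage stopped at the earlier of K and the exit index, written as
    a sum so that expectations can be taken termwise.\<close>
  define W where "W K \<omega> = Z 0 \<omega> + (\<Sum>k<K. if E \<omega> k then Z (Suc k) \<omega> - Z k \<omega> else 0)" for K \<omega>
  have W_eq: "W K \<omega> = Z (if \<forall>k<K. E \<omega> k then K else LEAST k. \<not> E \<omega> k) \<omega>" for K \<omega>
    unfolding W_def using stopped_sequence_sum[of "E \<omega>" "\<lambda>k. Z k \<omega>" K] alive_antimono by (auto simp: E_def)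
  have "(\<lambda>K. expectation (W K)) \<longlonglongrightarrow> expectation (\<lambda>\<omega>. Z (\<rho> \<omega>) \<omega>)"
  proof (rule integral_dominated_convergence[where w = "\<lambda>_. 1"])
    show "W K \<in> borel_measurable P" for K
      unfolding W_def by measurable
    show "AE \<omega> in P. (\<lambda>K. W K \<omega>) \<longlonglongrightarrow> Z (\<rho> \<omega>) \<omega>"
      using AE_exit[OF mn]
    proof eventually_elim
      case (elim \<omega>)
      then obtain k where k: "\<not> E \<omega> k"
        by (auto simp: E_def)
      then have "W K \<omega> = Z (\<rho> \<omega>) \<omega>" if "Suc k \<le> K" for K
        using that by (auto simp: W_eq \<rho>_def)
      then show ?case
        by (intro tendsto_eventually eventually_sequentiallyI)
    qed
    \<comment> \<open>The bound must hold for all k off one null set because W evaluates Z at a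
      random index.\<close>
    have "AE \<omega> in P. \<forall>k. norm (Z k \<omega>) \<le> 1"
      unfolding Z_def AE_all_countable using AE_norm_discounted_le[OF u v \<theta>] by blast
    then show "AE \<omega> in P. norm (W K \<omega>) \<le> 1" for K
      by eventually_elim (simp add: W_eq)
  qed (use Z_\<rho> in auto)
  \<comment> \<open>Each retained difference has expectation (g - 1) E (Z_k; k < \<rho>), by the
    formulas for the present and the next epoch.\<close>
  moreover have "expectation (W K) = 1 - (1 - g) * (\<Sum>k<K. alive_transform m n u v \<theta> k)" for K
  proof -
    have int: "integrable P (\<lambda>\<omega>. of_bool (E \<omega> k) * Z l \<omega>)" for k l
      unfolding Z_def by (rule integrable_of_bool_discounted[OF u v \<theta>]) measurable
    have "integrable P (Z 0)"
      using integrable_of_bool_discounted[OF u v \<theta>, of "\<lambda>_. True" 0] by (simp add: Z_def)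
    moreover have "W K = (\<lambda>\<omega>. Z 0 \<omega> + (\<Sum>k<K. of_bool (E \<omega> k) * Z (Suc k) \<omega> - of_bool (E \<omega> k) * Z k \<omega>))"
      unfolding W_def by (intro ext arg_cong2[where f = "(+)"] sum.cong refl) auto
    ultimately have "expectation (W K) = expectation (Z 0) +
        (\<Sum>k<K. expectation (\<lambda>\<omega>. of_bool (E \<omega> k) * Z (Suc k) \<omega>) - expectation (\<lambda>\<omega>. of_bool (E \<omega> k) * Z k \<omega>))"
      using int by simp
    also have "expectation (Z 0) = expectation (\<lambda>_. 1)"
    proof (rule integral_cong_AE)
      show "AE \<omega> in P. Z 0 \<omega> = 1"
        using AE_cum_damage[of 0] A.AE_count_0 B.AE_count_0
        by eventually_elim (simp add: Z_def discounted_def)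
    qed measurable
    finally show ?thesis
      unfolding E_def Z_def expectation_alive_now[OF u v \<theta>] expectation_alive_next[OF u v \<theta>]
        g_def[symmetric] sum_subtractf sum_distrib_left[symmetric]
      by (simp add: A.prob_space algebra_simps)
  qed
  moreover have "(\<lambda>K. 1 - (1 - g) * (\<Sum>k<K. alive_transform m n u v \<theta> k)) \<longlonglongrightarrow> 1 - (1 - g) * (1 + \<gamma> / D * T)"
    using sums_alive_transform[OF u v \<theta> mn D] unfolding sums_def T_def m_def n_def
    by (intro tendsto_intros)
  ultimately show ?thesis
    unfolding exit using LIMSEQ_unique by (metis (no_types, lifting) ext)
qed

end

section \<open>Closed form of the exit functional\<close>

theorem theorem3:
  fixes P :: "'w measure"
    and s t :: "nat \<Rightarrow> 'w \<Rightarrow> real" and w z :: "nat \<Rightarrow> 'w \<Rightarrow> nat"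
    and \<Delta> :: "nat \<Rightarrow> 'w \<Rightarrow> real"
    and lam \<mu> \<gamma> M N :: real and u v \<theta> :: complex
  assumes "prob_space P"
    and "0 < lam" and "0 < \<mu>" and "0 < \<gamma>" and "0 < M" and "0 < N"
    and "poisson_process P lam s w" and "poisson_process P \<mu> t z"
    and "\<And>j. 1 \<le> j \<Longrightarrow> AE \<omega> in P. w j \<omega> = 1"
    and "\<And>k. 1 \<le> k \<Longrightarrow> AE \<omega> in P. z k \<omega> = 1"
    and "renewal_exponential P \<gamma> \<Delta>"
    and "indep_elements P point_space (points s w) point_space (points t z)"
    and "indep_elements P
           (point_space \<Otimes>\<^sub>M point_space) (\<lambda>\<omega>. (points s w \<omega>, points t z \<omega>))
           times_space (times_seq \<Delta>)"
    and "norm u \<le> 1" and "norm v \<le> 1" and "0 \<le> Re \<theta>"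
  shows "exit_functional P (cum_damage s w \<Delta>) (cum_damage t z \<Delta>) (epoch \<Delta>) M N u v \<theta> =
    \<gamma> / (\<gamma> + lam * (1 - u) + \<mu> * (1 - v) + \<theta>) *
      (1 - (lam * (1 - u) + \<mu> * (1 - v) + \<theta>) / (lam + \<mu> * (1 - v) + \<theta>) *
        psi lam \<mu> (nat \<lceil>M\<rceil>) (nat \<lceil>N\<rceil>) u v \<theta>)"
proof -
  have "unit_poisson_process P lam s w" "unit_poisson_process P \<mu> t z"
    by (intro unit_poisson_process.intro unit_poisson_process_axioms.intro assms, assumption)+
  then interpret observed_game P lam s w \<mu> t z \<gamma> \<Delta>
    by (intro observed_game.intro observed_game_axioms.intro assms)
  define K where "K = lam * (1 - u) + \<mu> * (1 - v) + \<theta>"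
  define D where "D = lam + \<mu> + \<theta>"
  define T where "T = (\<Sum>p<nat \<lceil>M\<rceil>. \<Sum>q<nat \<lceil>N\<rceil>. of_nat ((p + q) choose p) * (lam * u / D) ^ p * (\<mu> * v / D) ^ q)"
  have re: "Re u \<le> 1" "Re v \<le> 1"
    using assms(14,15) complex_Re_le_cmod[of u] complex_Re_le_cmod[of v] by linarith+
  have le: "lam * Re u \<le> lam" "\<mu> * Re v \<le> \<mu>"
    using assms(2,3) re by (auto intro!: mult_left_le)
  \<comment> \<open>Since lam (1 - Re u), \<mu> (1 - Re v) and Re \<theta> are nonnegative, the
    lower bounds are \<gamma>, lam + \<mu> and lam respectively.\<close>
  have "0 < Re (\<gamma> + K)" "0 < Re D" "0 < Re (D - \<mu> * v)"
    by (simp_all add: K_def D_def right_diff_distrib) (insert le assms(2-4,16), linarith)+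
  then have nz: "\<gamma> + K \<noteq> 0" "D \<noteq> 0" "D - \<mu> * v \<noteq> 0"
    by (metis less_irrefl zero_complex.sel(1))+
  have D: "D = complex_of_real lam + complex_of_real \<mu> + \<theta>"
    by (simp add: D_def)
  have DK: "lam + \<mu> * (1 - v) + \<theta> = D - \<mu> * v" "K = D - \<mu> * v - lam * u"
    by (simp_all add: D_def K_def algebra_simps)
  have "exit_functional P (cum_damage s w \<Delta>) (cum_damage t z \<Delta>) (epoch \<Delta>) M N u v \<theta> =
      1 - (1 - \<gamma> / (\<gamma> + K)) * (1 + \<gamma> / D * T)"
    using exit_functional_eq[OF assms(14-16,5,6) D_def] by (simp add: T_def K_def add.assoc)
  also have "\<dots> = \<gamma> / (\<gamma> + K) * (1 - K / D * T)"
  proof -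
    \<comment> \<open>With g = \<gamma> / (\<gamma> + K) one has 1 - g = K / (\<gamma> + K), so
      \<gamma> (1 - g) = g K and g can be factored out.\<close>
    have "(1 - \<gamma> / (\<gamma> + K)) * \<gamma> = \<gamma> / (\<gamma> + K) * K"
      using nz(1) by (simp add: field_simps)
    then have "(1 - \<gamma> / (\<gamma> + K)) * (\<gamma> / D * T) = \<gamma> / (\<gamma> + K) * (K / D * T)"
      by (metis (no_types, lifting) mult.assoc times_divide_eq_right)
    then show ?thesis
      by (simp only: distrib_left right_diff_distrib) simp
  qed
  also have "K / D * T = K / (D - \<mu> * v) * psi lam \<mu> (nat \<lceil>M\<rceil>) (nat \<lceil>N\<rceil>) u v \<theta>"
  \<comment> \<open>K = 0 is the case b = 1, where \<open>psi\<close> divides by zero; there the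
    prefactor K makes both sides 0.\<close>
  proof (cases "K = 0")
    case False
    then have "psi lam \<mu> (nat \<lceil>M\<rceil>) (nat \<lceil>N\<rceil>) u v \<theta> = (1 - \<mu> * v / D) * T"
      unfolding T_def using assms(5,6) nz by (intro psi_eq_binomial_sum[OF _ _ D]) (auto simp: DK)
    also have "1 - \<mu> * v / D = (D - \<mu> * v) / D"
      using nz by (simp add: field_simps)
    finally show ?thesis
      using nz by simp
  qed simp
  finally show ?thesis
    unfolding DK(1)[symmetric] by (simp add: K_def add.assoc)
qed

end
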